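(* Fix $\delta>0$ and let $p=p(n)\in(0,1)$. If $n^{1/2}p\to\infty$ and $p\to 0$ as $n\to\infty$, then \[\lim_{n\to\infty}\frac{\phi(n,p,\delta)}{n^2p^2\log(1/p)}=\min\Big\{\frac{\delta^{2/3}}{2},\frac{\delta}{3}\Big\}.\] If instead $np\to\infty$ and $n^{1/2}p\to 0$ as $n\to\infty$, then \[\lim_{n\to\infty}\frac{\phi(n,p,\delta)}{n^2p^2\log(1/p)}=\frac{\delta^{2/3}}{2}.\]
   Context: For $0<p<1$ and $x\in[0,1]$ let $I_p(x)=x\log\frac{x}{p}+(1-x)\log\frac{1-x}{1-p}$ (with $0\log 0=0$). Let $\mathscr{G}_n$ be the set of weighted graphs $G=(g_{ij})$ on $n$ vertices: $0\le g_{ij}\le 1$, $g_{ij}=g_{ji}$, $g_{ii}=0$. Define $t(G)=n^{-3}\sum_{1\le i,j,k\le n}g_{ij}g_{jk}g_{ik}$ and $I_p(G)=\sum_{1\le i<j\le n}I_p(g_{ij})$. For $\delta>0$, $0<p<1$, let $\phi(n,p,\delta)=\inf\{I_p(G): G\in\mathscr{G}_n,\ t(G)\ge(1+\delta)p^3\}$. *)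

theory Defs
  imports "HOL-Analysis.Analysis"
begin

(* At x = 0 and x = 1 the vanishing factor x resp. 1 - x yields the convention 0 log 0 = 0. *)
definition rel_entropy :: "real \<Rightarrow> real \<Rightarrow> real" where
  "rel_entropy p x = x * ln (x / p) + (1 - x) * ln ((1 - x) / (1 - p))"

(* The vertices are 1, ..., n. Entries of g outside {1..n} x {1..n} are unconstrained;
   the functionals below do not depend on them. *)
definition weighted_graphs :: "nat \<Rightarrow> (nat \<Rightarrow> nat \<Rightarrow> real) set" where
  "weighted_graphs n = {g. \<forall>i\<in>{1..n}. g i i = 0 \<and>
     (\<forall>j\<in>{1..n}. 0 \<le> g i j \<and> g i j \<le> 1 \<and> g i j = g j i)}"

definition triangle_density :: "nat \<Rightarrow> (nat \<Rightarrow> nat \<Rightarrow> real) \<Rightarrow> real" where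
  "triangle_density n g =
     (\<Sum>i\<in>{1..n}. \<Sum>j\<in>{1..n}. \<Sum>k\<in>{1..n}. g i j * g j k * g i k) / real n ^ 3"

definition graph_entropy :: "nat \<Rightarrow> real \<Rightarrow> (nat \<Rightarrow> nat \<Rightarrow> real) \<Rightarrow> real" where
  "graph_entropy n p g = (\<Sum>(i, j) \<in> {(i, j). 1 \<le> i \<and> i < j \<and> j \<le> n}. rel_entropy p (g i j))"

(* Extended-real valued, so that the infimum is infinity when no graph is admissible
   (e.g. when (1 + \<delta>) p^3 > 1). *)
definition phi :: "nat \<Rightarrow> real \<Rightarrow> real \<Rightarrow> ereal" where
  "phi n p \<delta> = (INF g \<in> {g \<in> weighted_graphs n. triangle_density n g \<ge> (1 + \<delta>) * p ^ 3}.
     ereal (graph_entropy n p g))"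

end

theory Submission
  imports Defs
begin

text \<open>
  Write \<open>u = (g - p)\<^sup>+\<close> and \<open>L = ln (1 / p)\<close>. The relative entropy at \<open>g\<close> is at least
  \<open>F(u) = (p + u) ln (1 + u / p) - u\<close>, which is convex, while \<open>F(u) / u\<^sup>2\<close> is decreasing; hence
  \<open>F(u) \<ge> (1 - o(1)) L u\<^sup>2\<close> on \<open>[0, 1]\<close>, and the constant improves to order \<open>1 / b\<close> on \<open>[0, b]\<close>. If the total
  entropy is \<open>O(n\<^sup>2 p\<^sup>2 L)\<close>, then Jensen's inequality along rows shows that only \<open>O(n p\<^sup>2 / b)\<close> vertices have
  excess degree at least \<open>b n\<close>, and that the remaining vertices contribute negligibly to \<open>\<Sum>\<^sub>i d\<^sub>i\<^sup>2\<close>.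
  Expanding \<open>\<Sum> (p + u\<^sub>i\<^sub>j) (p + u\<^sub>j\<^sub>k) (p + u\<^sub>i\<^sub>k)\<close> and using Cauchy-Schwarz, the excess of triangles forces
  \<open>y\<^bsup>3/2\<^esup> + 3 x \<ge> \<delta> - o(1)\<close> for the rescaled energies \<open>y\<close> of \<open>u\<close> among light vertices and \<open>x\<close> between
  heavy and light ones, at a cost of \<open>x + y / 2\<close>. By concavity the minimum is at \<open>x = 0\<close> (a planted clique
  of size \<open>\<delta>\<^bsup>1/3\<^esup> n p\<close>) or at \<open>y = 0\<close> (about \<open>\<delta> n p\<^sup>2 / 3\<close> vertices joined to everything). If \<open>n p\<^sup>2 \<rightarrow> 0\<close>, there
  are no heavy vertices at all, so \<open>x = 0\<close>.
\<close>

section \<open>Entropy of the excess\<close>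

text \<open>The relative entropy of a Poisson law of mean \<open>p + u\<close> with respect to one of mean \<open>p\<close>.\<close>
definition poisson_entropy :: "real \<Rightarrow> real \<Rightarrow> real" where
  "poisson_entropy p u = (p + u) * ln (1 + u / p) - u"

lemma poisson_entropy_0 [simp]: "poisson_entropy p 0 = 0"
  by (simp add: poisson_entropy_def)

text \<open>Gibbs' inequality \<open>a - c \<le> a * ln (a / c)\<close> bounds the term in
  \<open>1 - x\<close> below by \<open>p - x\<close>, which is the summand \<open>-u\<close> of the
  Poisson entropy. For \<open>x \<le> p\<close> the same inequality for the other term cancels it
  and leaves 0.\<close>

lemma rel_entropy_ge_poisson_entropy:
  assumes "0 < p" "p < 1" "0 \<le> x" "x \<le> 1"
  shows "poisson_entropy p (max (x - p) 0) \<le> rel_entropy p x"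
proof -
  have gibbs: "a - c \<le> a * ln (a / c)" if "0 \<le> a" "0 < c" for a c :: real
  proof (cases "a = 0")
    case False
    with that have "ln (c / a) \<le> c / a - 1"
      by (intro ln_le_minus_one) auto
    hence "a * ln (c / a) \<le> a * (c / a - 1)"
      using that by (intro mult_left_mono) auto
    moreover have "a * (c / a - 1) = c - a"
      using False by (simp add: field_simps)
    moreover have "ln (a / c) = - ln (c / a)"
      using that False by (simp add: ln_div)
    ultimately show ?thesis
      by simp
  qed (use that in auto)
  have 1: "(1 - x) - (1 - p) \<le> (1 - x) * ln ((1 - x) / (1 - p))"
    using assms by (intro gibbs) auto
  show ?thesis
  proof (cases "x \<le> p")
    case True
    have "x - p \<le> x * ln (x / p)"
      using assms by (intro gibbs) auto
    with 1 True show ?thesis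
      by (simp add: rel_entropy_def max_def)
  next
    case False
    have "1 + (x - p) / p = x / p"
      using assms by (simp add: field_simps)
    with 1 False show ?thesis
      by (simp add: rel_entropy_def poisson_entropy_def max_def)
  qed
qed

text \<open>Convexity in tangent form: \<open>ln (1 + v / p)\<close> is the derivative at
  \<open>v\<close>. The difference of the two sides is \<open>(v - u) - (p + u) * ln z\<close> with
  \<open>z = (p + v) / (p + u)\<close>, so \<open>ln z \<le> z - 1\<close> suffices.\<close>

lemma poisson_entropy_tangent:
  assumes "0 < p" "0 \<le> u" "0 \<le> v"
  shows "poisson_entropy p v + ln (1 + v / p) * (u - v) \<le> poisson_entropy p u"
proof -
  have "ln ((p + v) / (p + u)) \<le> (p + v) / (p + u) - 1"
    using assms by (intro ln_le_minus_one) auto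
  also have "\<dots> = (v - u) / (p + u)"
    using assms by (simp add: field_simps)
  finally have "(p + u) * ln ((p + v) / (p + u)) \<le> v - u"
    using assms by (simp add: field_simps)
  moreover have "ln ((p + v) / (p + u)) = ln (1 + v / p) - ln (1 + u / p)"
  proof -
    have "1 + v / p = (p + v) / p" "1 + u / p = (p + u) / p"
      using assms by (auto simp: field_simps)
    thus ?thesis
      using assms by (simp add: ln_div)
  qed
  ultimately show ?thesis
    by (simp add: poisson_entropy_def algebra_simps)
qed

lemma poisson_entropy_mono:
  assumes "0 < p" "0 \<le> u" "u \<le> v"
  shows "poisson_entropy p u \<le> poisson_entropy p v"
proof -
  have "0 \<le> ln (1 + u / p) * (v - u)"
    using assms by simp
  moreover have "poisson_entropy p u + ln (1 + u / p) * (v - u) \<le> poisson_entropy p v"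
    using assms by (intro poisson_entropy_tangent) auto
  ultimately show ?thesis
    by linarith
qed

lemma poisson_entropy_nonneg:
  "0 < p \<Longrightarrow> 0 \<le> u \<Longrightarrow> 0 \<le> poisson_entropy p u"
  using poisson_entropy_mono[of p 0 u] by simp

text \<open>Sum the tangent inequality at the mean \<open>m\<close>; the linear terms
  cancel.\<close>

lemma poisson_entropy_jensen:
  assumes "finite A" "A \<noteq> {}" "0 < p" "\<And>x. x \<in> A \<Longrightarrow> 0 \<le> f x"
  shows "real (card A) * poisson_entropy p (sum f A / real (card A))
           \<le> (\<Sum>x\<in>A. poisson_entropy p (f x))"
proof -
  define m where "m = sum f A / real (card A)"
  have "0 < card A"
    using assms by (simp add: card_gt_0_iff)
  have "0 \<le> m"
    using assms by (auto simp: m_def intro!: divide_nonneg_nonneg sum_nonneg)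
  have "(\<Sum>x\<in>A. poisson_entropy p m + ln (1 + m / p) * (f x - m)) \<le> (\<Sum>x\<in>A. poisson_entropy p (f x))"
    using assms \<open>0 \<le> m\<close> by (intro sum_mono poisson_entropy_tangent) auto
  moreover have "(\<Sum>x\<in>A. f x - m) = 0"
    using \<open>0 < card A\<close> by (simp add: sum_subtractf m_def)
  ultimately show ?thesis
    by (simp add: sum.distrib m_def flip: sum_distrib_left)
qed

text \<open>The difference vanishes at 0 and has derivative
  \<open>t^2 / ((1 + t) * (2 + t)^2)\<close>. With \<open>y = u / p\<close> this is the inequality
  behind both the rational lower bound and the monotonicity of the entropy divided by
  \<open>u^2\<close>.\<close>

lemma ln_one_plus_ge:
  fixes y :: real
  assumes "0 \<le> y"
  shows "2 * y / (2 + y) \<le> ln (1 + y)"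
proof -
  let ?f = "\<lambda>y::real. ln (1 + y) - 2 * y / (2 + y)"
  have "?f 0 \<le> ?f y"
  proof (rule DERIV_nonneg_imp_nondecreasing[OF assms])
    fix t :: real
    assume "0 \<le> t" "t \<le> y"
    have "(?f has_real_derivative (1 / (1 + t) - 4 / (2 + t)^2)) (at t)"
      using \<open>0 \<le> t\<close> by (auto intro!: derivative_eq_intros simp: power2_eq_square field_simps)
    moreover have "1 / (1 + t) - 4 / (2 + t)^2 = t^2 / ((1 + t) * (2 + t)^2)"
      using \<open>0 \<le> t\<close> by (simp add: divide_simps power2_eq_square) (simp add: algebra_simps)
    ultimately show "\<exists>d. (?f has_real_derivative d) (at t) \<and> 0 \<le> d"
      using \<open>0 \<le> t\<close> by (intro exI[of _ "1 / (1 + t) - 4 / (2 + t)^2"]) auto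
  qed
  thus ?thesis
    by simp
qed

text \<open>Needed at the scale \<open>u = \<epsilon> * p\<close>, where the entropy is of order
  \<open>p\<close> and the logarithmic bound for fixed \<open>b\<close> says nothing.\<close>

lemma poisson_entropy_ge_rational:
  assumes "0 < p" "0 \<le> u"
  shows "u^2 / (2 * p + u) \<le> poisson_entropy p u"
proof -
  have "2 * u / (2 * p + u) = 2 * (u / p) / (2 + u / p)"
    using assms by (simp add: field_simps)
  also have "\<dots> \<le> ln (1 + u / p)"
    using assms by (intro ln_one_plus_ge) auto
  finally have "(p + u) * (2 * u / (2 * p + u)) \<le> (p + u) * ln (1 + u / p)"
    using assms by (intro mult_left_mono) auto
  moreover have "(p + u) * (2 * u / (2 * p + u)) - u = u^2 / (2 * p + u)"
    using assms by (simp add: divide_simps power2_eq_square) (simp add: algebra_simps)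
  ultimately show ?thesis
    by (simp add: poisson_entropy_def)
qed

text \<open>The negated quotient has derivative
  \<open>((2 * p + t) * ln (1 + t / p) - 2 * t) / t^3\<close>, nonnegative by
  \<open>ln_one_plus_ge\<close>. Cross-multiplication includes \<open>u = 0\<close>. The consequence
  is a quadratic lower bound on all of \<open>[0, b]\<close> from the single value at
  \<open>b\<close>.\<close>

lemma poisson_entropy_over_square_antimono:
  assumes "0 < p" "0 \<le> u" "u \<le> b"
  shows "u^2 * poisson_entropy p b \<le> b^2 * poisson_entropy p u"
proof (cases "u = 0")
  case False
  let ?f = "\<lambda>t. - (poisson_entropy p t / t^2)"
  have "?f u \<le> ?f b"
  proof (rule DERIV_nonneg_imp_nondecreasing[OF assms(3)])
    fix t :: real
    assume "u \<le> t" "t \<le> b"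
    hence "0 < t"
      using False assms by auto
    have [simp]: "1 + t / p = (p + t) / p"
      using assms by (simp add: field_simps)
    let ?l = "ln (1 + t / p)"
    have "(poisson_entropy p has_real_derivative ?l) (at t)"
      unfolding poisson_entropy_def[abs_def] using assms \<open>0 < t\<close>
      by (auto intro!: derivative_eq_intros simp: add_pos_pos divide_simps)
    hence "(?f has_real_derivative - ((?l * t^2 - poisson_entropy p t * (2 * t)) / (t^2 * t^2))) (at t)"
      using \<open>0 < t\<close> by (auto intro!: derivative_eq_intros)
    moreover have "- ((?l * t^2 - poisson_entropy p t * (2 * t)) / (t^2 * t^2))
        = ((2 * p + t) * ?l - 2 * t) / t^3"
      using \<open>0 < t\<close>
      by (simp add: poisson_entropy_def field_simps power2_eq_square power3_eq_cube)
    moreover have "2 * t \<le> (2 * p + t) * ?l"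
    proof -
      have "2 * t / (2 * p + t) = 2 * (t / p) / (2 + t / p)"
        using assms \<open>0 < t\<close> by (simp add: field_simps)
      also have "\<dots> \<le> ?l"
        using assms \<open>0 < t\<close> by (intro ln_one_plus_ge) auto
      finally show ?thesis
        using assms \<open>0 < t\<close> by (simp add: field_simps)
    qed
    ultimately show "\<exists>d. (?f has_real_derivative d) (at t) \<and> 0 \<le> d"
      using \<open>0 < t\<close> by (intro exI[of _ "((2 * p + t) * ?l - 2 * t) / t^3"]) auto
  qed
  thus ?thesis
    using False assms by (simp add: field_simps)
qed simp

text \<open>Dropping \<open>p\<close> from the factor and 1 from the logarithm keeps the leading
  term \<open>b * ln (1 / p)\<close> as \<open>p\<close> tends to 0 with \<open>b\<close>
  fixed.\<close>

lemma poisson_entropy_ge_ln: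
  assumes "0 < p" "0 < b"
  shows "b * (ln (1 / p) + ln b - 1) \<le> poisson_entropy p b"
proof -
  have "b * ln (b / p) \<le> (p + b) * ln (1 + b / p)"
  proof -
    have "b * ln (b / p) \<le> b * ln (1 + b / p)"
      using assms by (intro mult_left_mono) (auto simp: field_simps)
    also have "\<dots> \<le> (p + b) * ln (1 + b / p)"
      using assms by (intro mult_right_mono) auto
    finally show ?thesis .
  qed
  moreover have "ln (b / p) = ln (1 / p) + ln b"
    using assms by (simp add: ln_div)
  ultimately show ?thesis
    by (simp add: poisson_entropy_def algebra_simps)
qed

section \<open>Triangle sums\<close>

text \<open>For symmetric \<open>v\<close> this bounds the trace of the cube by the cube of the
  Hilbert-Schmidt norm. Cauchy-Schwarz is used twice: to bound each entry of \<open>w\<close>, then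
  to pair \<open>v\<close> with \<open>w\<close>.\<close>

lemma sum_triangles_le:
  fixes v :: "'a \<Rightarrow> 'a \<Rightarrow> real"
  shows "(\<Sum>i\<in>V. \<Sum>j\<in>V. \<Sum>k\<in>V. v i j * v j k * v i k)
           \<le> (\<Sum>i\<in>V. \<Sum>j\<in>V. (v i j)^2) powr (3/2)" (is "?t \<le> ?q powr _")
proof -
  define w where "w i j = (\<Sum>k\<in>V. v j k * v i k)" for i j
  have "0 \<le> ?q"
    by (intro sum_nonneg) auto
  have "?t = (\<Sum>i\<in>V. \<Sum>j\<in>V. v i j * w i j)"
    by (simp add: w_def sum_distrib_left mult.assoc)
  also have "\<dots> = (\<Sum>(i, j)\<in>V \<times> V. v i j * w i j)"
    by (simp add: sum.cartesian_product)
  finally have t: "?t = (\<Sum>(i, j)\<in>V \<times> V. v i j * w i j)" .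
  have "(w i j)^2 \<le> (\<Sum>k\<in>V. (v j k)^2) * (\<Sum>k\<in>V. (v i k)^2)" for i j
    unfolding w_def by (rule Cauchy_Schwarz_ineq_sum)
  hence "(\<Sum>i\<in>V. \<Sum>j\<in>V. (w i j)^2)
      \<le> (\<Sum>i\<in>V. \<Sum>j\<in>V. (\<Sum>k\<in>V. (v j k)^2) * (\<Sum>k\<in>V. (v i k)^2))"
    by (intro sum_mono)
  also have "\<dots> = ?q^2"
    by (simp add: power2_eq_square sum_product mult.commute)
  finally have w: "(\<Sum>i\<in>V. \<Sum>j\<in>V. (w i j)^2) \<le> ?q^2" .
  have "?t^2 \<le> (\<Sum>(i, j)\<in>V \<times> V. (v i j)^2) * (\<Sum>(i, j)\<in>V \<times> V. (w i j)^2)"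
    unfolding t
    using Cauchy_Schwarz_ineq_sum[of "\<lambda>(i, j). v i j" "\<lambda>(i, j). w i j" "V \<times> V"]
    by (simp add: case_prod_unfold)
  also have "\<dots> = ?q * (\<Sum>i\<in>V. \<Sum>j\<in>V. (w i j)^2)"
    by (simp add: sum.cartesian_product)
  also have "\<dots> \<le> ?q * ?q^2"
    using w \<open>0 \<le> ?q\<close> by (rule mult_left_mono)
  also have "\<dots> = ?q^3"
    by (simp only: power2_eq_square power3_eq_cube mult.assoc)
  also have "\<dots> = ?q powr (3/2 + 3/2)"
    using \<open>0 \<le> ?q\<close> by simp
  also have "\<dots> = (?q powr (3/2))^2"
    by (simp only: power2_eq_square powr_add)
  finally show ?thesis
    by (rule power2_le_imp_le) simp
qed

text \<open>In the expanded product each single factor of \<open>u\<close> sums to \<open>n\<close>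
  times the total weight. Any two factors share a vertex, so by symmetry and reordering of the sums
  they give the sum of squared degrees.\<close>

lemma sum_shifted_triangles:
  fixes u :: "'a \<Rightarrow> 'a \<Rightarrow> real"
  assumes "\<And>i j. i \<in> V \<Longrightarrow> j \<in> V \<Longrightarrow> u i j = u j i"
  defines "n \<equiv> real (card V)"
  shows "(\<Sum>i\<in>V. \<Sum>j\<in>V. \<Sum>k\<in>V. (p + u i j) * (p + u j k) * (p + u i k))
    = n^3 * p^3 + 3 * p^2 * n * (\<Sum>i\<in>V. \<Sum>j\<in>V. u i j) + 3 * p * (\<Sum>i\<in>V. (\<Sum>j\<in>V. u i j)^2)
      + (\<Sum>i\<in>V. \<Sum>j\<in>V. \<Sum>k\<in>V. u i j * u j k * u i k)"
proof -
  let ?S = "\<Sum>i\<in>V. \<Sum>j\<in>V. u i j"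
  let ?D = "\<Sum>i\<in>V. (\<Sum>j\<in>V. u i j)^2"
  let ?s = "\<lambda>f::'a \<Rightarrow> 'a \<Rightarrow> 'a \<Rightarrow> real. \<Sum>i\<in>V. \<Sum>j\<in>V. \<Sum>k\<in>V. f i j k"
  have "(p + u i j) * (p + u j k) * (p + u i k) =
     p^3 + p^2 * u i j + p^2 * u j k + p^2 * u i k + p * (u i j * u j k) + p * (u i j * u i k)
       + p * (u i k * u j k) + u i j * u j k * u i k" for i j k
    by (simp add: algebra_simps power2_eq_square power3_eq_cube)
  hence 1: "?s (\<lambda>i j k. (p + u i j) * (p + u j k) * (p + u i k)) =
     ?s (\<lambda>i j k. p^3) + p^2 * ?s (\<lambda>i j k. u i j) + p^2 * ?s (\<lambda>i j k. u j k) + p^2 * ?s (\<lambda>i j k. u i k)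
     + p * ?s (\<lambda>i j k. u i j * u j k) + p * ?s (\<lambda>i j k. u i j * u i k)
     + p * ?s (\<lambda>i j k. u i k * u j k) + ?s (\<lambda>i j k. u i j * u j k * u i k)"
    by (simp only: sum.distrib sum_distrib_left)
  have 2: "?s (\<lambda>i j k. p^3) = n^3 * p^3"
    by (simp add: n_def power3_eq_cube)
  have 3: "?s (\<lambda>i j k. u i j) = n * ?S" "?s (\<lambda>i j k. u j k) = n * ?S" "?s (\<lambda>i j k. u i k) = n * ?S"
    by (simp_all only: n_def sum_distrib_left sum_constant)
  have 4: "?s (\<lambda>i j k. u i j * u i k) = ?D"
    by (simp add: power2_eq_square sum_product)
  have 5: "?s (\<lambda>i j k. u i j * u j k) = ?D"
  proof -
    have "?s (\<lambda>i j k. u i j * u j k) = ?s (\<lambda>i j k. u j i * u j k)"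
      using assms(1) by (intro sum.cong refl) simp
    also have "\<dots> = ?s (\<lambda>j i k. u j i * u j k)"
      by (rule sum.swap)
    also have "\<dots> = ?D"
      by (simp add: power2_eq_square sum_product)
    finally show ?thesis .
  qed
  have 6: "?s (\<lambda>i j k. u i k * u j k) = ?D"
  proof -
    have "?s (\<lambda>i j k. u i k * u j k) = ?s (\<lambda>i k j. u i k * u j k)"
      by (intro sum.cong refl sum.swap)
    also have "\<dots> = ?s (\<lambda>k i j. u i k * u j k)"
      by (rule sum.swap)
    also have "\<dots> = ?s (\<lambda>k i j. u k i * u k j)"
      using assms(1) by (intro sum.cong refl) simp
    also have "\<dots> = ?D"
      by (simp add: power2_eq_square sum_product)
    finally show ?thesis .
  qed
  show ?thesis
    unfolding 1 2 3 4 5 6 by (simp only: algebra_simps)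
qed

text \<open>A triple with a vertex in \<open>B\<close> weighs at most the edge opposite that vertex,
  since the other factors are at most 1; the three positions give the term with
  \<open>card B\<close>. The remaining triples are those of \<open>u\<close> with the rows and
  columns of \<open>B\<close> set to 0, to which \<open>sum_triangles_le\<close> applies.\<close>

lemma sum_triangles_le_remove:
  fixes u :: "'a \<Rightarrow> 'a \<Rightarrow> real"
  assumes "finite V" "B \<subseteq> V" "\<And>i j. i \<in> V \<Longrightarrow> j \<in> V \<Longrightarrow> 0 \<le> u i j \<and> u i j \<le> 1"
  shows "(\<Sum>i\<in>V. \<Sum>j\<in>V. \<Sum>k\<in>V. u i j * u j k * u i k)
    \<le> (\<Sum>i\<in>V - B. \<Sum>j\<in>V - B. (u i j)^2) powr (3/2) + 3 * real (card B) * (\<Sum>i\<in>V. \<Sum>j\<in>V. u i j)"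
proof -
  let ?S = "\<Sum>i\<in>V. \<Sum>j\<in>V. u i j"
  let ?s = "\<lambda>f::'a \<Rightarrow> 'a \<Rightarrow> 'a \<Rightarrow> real. \<Sum>i\<in>V. \<Sum>j\<in>V. \<Sum>k\<in>V. f i j k"
  define b where "b i = (of_bool (i \<in> B) :: real)" for i
  let ?c = "\<lambda>i. of_bool (i \<notin> B) :: real"
  let ?v = "\<lambda>i j. ?c i * ?c j * u i j"
  have sum_b: "(\<Sum>i\<in>V. b i) = real (card B)"
    using assms(1,2) by (simp add: b_def sum.If_cases of_bool_def Int_absorb1)
  have "u i j * u j k * u i k \<le> ?v i j * ?v j k * ?v i k + b i * u j k + b j * u i k + b k * u i j"
    if "i \<in> V" "j \<in> V" "k \<in> V" for i j k
  proof -
    have m: "x * y * z \<le> y" "x * y * z \<le> z" "x * y * z \<le> x"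
      if "0 \<le> x" "0 \<le> y" "0 \<le> z" "x \<le> 1" "y \<le> 1" "z \<le> 1" for x y z :: real
      using that mult_left_le_one_le[of y "x * z"] mult_left_le_one_le[of z "x * y"]
        mult_left_le_one_le[of x "y * z"] mult_le_one[of x y] mult_le_one[of x z] mult_le_one[of y z]
      by (simp_all add: mult_ac)
    have u: "0 \<le> u i j" "0 \<le> u j k" "0 \<le> u i k" "u i j \<le> 1" "u j k \<le> 1" "u i k \<le> 1"
      using assms(3) that by auto
    show ?thesis
      using m[of "u i j" "u j k" "u i k"] u by (auto simp: b_def intro!: add_nonneg_nonneg order_trans[OF m(1)])
  qed
  hence "?s (\<lambda>i j k. u i j * u j k * u i k) \<le>
      ?s (\<lambda>i j k. ?v i j * ?v j k * ?v i k + b i * u j k + b j * u i k + b k * u i j)"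
    by (intro sum_mono)
  also have "\<dots> = ?s (\<lambda>i j k. ?v i j * ?v j k * ?v i k) + ?s (\<lambda>i j k. b i * u j k)
      + ?s (\<lambda>i j k. b j * u i k) + ?s (\<lambda>i j k. b k * u i j)"
    by (simp only: sum.distrib)
  also have "?s (\<lambda>i j k. b i * u j k) = real (card B) * ?S"
    by (simp only: sum_b flip: sum_distrib_left sum_distrib_right)
  also have "?s (\<lambda>i j k. b j * u i k) = real (card B) * ?S"
    by (subst sum.swap) (simp only: sum_b flip: sum_distrib_left sum_distrib_right)
  also have "?s (\<lambda>i j k. b k * u i j) = real (card B) * ?S"
    by (simp only: sum_b flip: sum_distrib_left sum_distrib_right)
  also have "?s (\<lambda>i j k. ?v i j * ?v j k * ?v i k) \<le> (\<Sum>i\<in>V. \<Sum>j\<in>V. (?v i j)^2) powr (3/2)"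
    by (rule sum_triangles_le)
  also have "(\<Sum>i\<in>V. \<Sum>j\<in>V. (?v i j)^2) = (\<Sum>i\<in>V - B. \<Sum>j\<in>V - B. (u i j)^2)"
    using assms(1) 
    by (intro sum.mono_neutral_cong_right ballI sum.neutral) (auto simp: of_bool_def)
  finally show ?thesis
    by simp
qed

section \<open>Splitting sums at the heavy vertices\<close>

lemma sum_sum_split:
  fixes f :: "'a \<Rightarrow> 'a \<Rightarrow> real"
  assumes "finite V" "B \<subseteq> V"
  shows "(\<Sum>i\<in>V. \<Sum>j\<in>V. f i j) = (\<Sum>i\<in>V - B. \<Sum>j\<in>V - B. f i j) + (\<Sum>i\<in>V - B. \<Sum>j\<in>B. f i j)
    + (\<Sum>i\<in>B. \<Sum>j\<in>V - B. f i j) + (\<Sum>i\<in>B. \<Sum>j\<in>B. f i j)"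
  using assms by (simp add: sum.subset_diff[of B V] sum.distrib)

text \<open>Cauchy-Schwarz against the constant vector in each row of \<open>B\<close>; the entries
  inside \<open>B\<close> are bounded by 1.\<close>

lemma sum_heavy_degree_squares_le:
  fixes u :: "'a \<Rightarrow> 'a \<Rightarrow> real"
  assumes "finite V" "B \<subseteq> V" "\<And>i j. i \<in> V \<Longrightarrow> j \<in> V \<Longrightarrow> 0 \<le> u i j \<and> u i j \<le> 1"
  shows "(\<Sum>i\<in>B. (\<Sum>j\<in>V. u i j)^2)
    \<le> real (card V) * ((\<Sum>i\<in>B. \<Sum>j\<in>V - B. (u i j)^2) + real (card B)^2)"
proof -
  have "(\<Sum>j\<in>V. u i j)^2 \<le> real (card V) * ((\<Sum>j\<in>V - B. (u i j)^2) + real (card B))" if "i \<in> B" for i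
  proof -
    have "(\<Sum>j\<in>V. u i j)^2 \<le> real (card V) * (\<Sum>j\<in>V. (u i j)^2)"
      using Cauchy_Schwarz_ineq_sum[of "\<lambda>_. 1" "u i" V] by simp
    also have "(\<Sum>j\<in>V. (u i j)^2) = (\<Sum>j\<in>V - B. (u i j)^2) + (\<Sum>j\<in>B. (u i j)^2)"
      using assms(1,2) by (simp add: sum.subset_diff[of B V])
    also have "(\<Sum>j\<in>B. (u i j)^2) \<le> (\<Sum>j\<in>B. 1)"
      using assms that by (intro sum_mono power_le_one) auto
    finally show ?thesis
      by (simp add: mult_left_mono)
  qed
  hence "(\<Sum>i\<in>B. (\<Sum>j\<in>V. u i j)^2)
      \<le> (\<Sum>i\<in>B. real (card V) * ((\<Sum>j\<in>V - B. (u i j)^2) + real (card B)))"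
    by (intro sum_mono)
  also have "\<dots> = real (card V) * ((\<Sum>i\<in>B. \<Sum>j\<in>V - B. (u i j)^2) + real (card B)^2)"
    by (simp add: sum.distrib power2_eq_square flip: sum_distrib_left)
  finally show ?thesis .
qed

text \<open>By Jensen, row \<open>i\<close> costs at least
  \<open>n * poisson_entropy p (d i / n)\<close>. A heavy row therefore costs at least
  \<open>n * b * L / 2\<close>, which bounds their number. For a light row \<open>d i / n\<close>
  lies in \<open>[0, b]\<close>, where the entropy is at least \<open>L / (2 * b)\<close> times the
  square, so its squared degree is bounded by its own cost.\<close>

lemma heavy_rows:
  fixes u :: "'a \<Rightarrow> 'a \<Rightarrow> real"
  assumes "finite V" "V \<noteq> {}" "\<And>i j. i \<in> V \<Longrightarrow> j \<in> V \<Longrightarrow> 0 \<le> u i j"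
    and "0 < p" "0 < b" "0 < L" "b * L / 2 \<le> poisson_entropy p b"
  defines "n \<equiv> real (card V)"
  defines "B \<equiv> {i \<in> V. b * n \<le> (\<Sum>j\<in>V. u i j)}"
  defines "T \<equiv> \<Sum>i\<in>V. \<Sum>j\<in>V. poisson_entropy p (u i j)"
  shows "real (card B) * b * L * n \<le> 2 * T"
    and "(\<Sum>i\<in>V - B. (\<Sum>j\<in>V. u i j)^2) \<le> 2 * b * n * T / L"
proof -
  define d where "d i = (\<Sum>j\<in>V. u i j)" for i
  define t where "t i = (\<Sum>j\<in>V. poisson_entropy p (u i j))" for i
  have "0 < n"
    using assms(1,2) by (simp add: n_def card_gt_0_iff)
  have d: "0 \<le> d i" if "i \<in> V" for i
    using assms(3) that by (auto simp: d_def intro!: sum_nonneg)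
  have t: "0 \<le> t i" if "i \<in> V" for i
    using assms(3,4) that by (auto simp: t_def intro!: sum_nonneg poisson_entropy_nonneg)
  have row: "n * poisson_entropy p (d i / n) \<le> t i" if "i \<in> V" for i
    unfolding n_def d_def t_def using assms(1-4) that by (intro poisson_entropy_jensen) auto
  have "B \<subseteq> V"
    by (auto simp: B_def)
  have T: "T = (\<Sum>i\<in>V - B. t i) + (\<Sum>i\<in>B. t i)"
    using assms(1) \<open>B \<subseteq> V\<close> by (simp add: T_def t_def sum.subset_diff)
  show "real (card B) * b * L * n \<le> 2 * T"
  proof -
    have "n * (b * L / 2) \<le> t i" if "i \<in> B" for i
    proof -
      have "b \<le> d i / n"
        using that \<open>0 < n\<close> by (simp add: B_def d_def field_simps)
      hence "poisson_entropy p b \<le> poisson_entropy p (d i / n)"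
        using assms(4,5) by (intro poisson_entropy_mono) auto
      with assms(7) have "n * (b * L / 2) \<le> n * poisson_entropy p (d i / n)"
        using \<open>0 < n\<close> by (intro mult_left_mono) auto
      with row[of i] that \<open>B \<subseteq> V\<close> show ?thesis
        by auto
    qed
    hence "(\<Sum>i\<in>B. n * (b * L / 2)) \<le> (\<Sum>i\<in>B. t i)"
      by (rule sum_mono)
    moreover have "0 \<le> (\<Sum>i\<in>V - B. t i)"
      using t by (intro sum_nonneg) auto
    ultimately show ?thesis
      by (simp add: T field_simps)
  qed
  show "(\<Sum>i\<in>V - B. (\<Sum>j\<in>V. u i j)^2) \<le> 2 * b * n * T / L"
  proof -
    have "(d i)^2 \<le> 2 * b * n / L * t i" if "i \<in> V - B" for i
    proof -
      define x where "x = d i / n"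
      have "0 \<le> x" "x \<le> b"
        using that \<open>0 < n\<close> d[of i] by (auto simp: x_def B_def d_def field_simps)
      hence "x^2 * poisson_entropy p b \<le> b^2 * poisson_entropy p x"
        using assms(4) by (intro poisson_entropy_over_square_antimono)
      moreover have "x^2 * (b * L / 2) \<le> x^2 * poisson_entropy p b"
        using assms(7) by (intro mult_left_mono) auto
      ultimately have "b * (x^2 * L) \<le> b * (2 * b * poisson_entropy p x)"
        by (simp add: power2_eq_square algebra_simps)
      hence "x^2 * L \<le> 2 * b * poisson_entropy p x"
        using assms(5) by simp
      hence "n^2 * (x^2 * L) \<le> n^2 * (2 * b * poisson_entropy p x)"
        by (intro mult_left_mono) auto
      also have "\<dots> = 2 * b * n * (n * poisson_entropy p x)"
        by (simp add: power2_eq_square)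
      also have "\<dots> \<le> 2 * b * n * t i"
        using row[of i] that assms(5) \<open>0 < n\<close> by (intro mult_left_mono) (auto simp: x_def)
      finally have "(n * x)^2 * L \<le> 2 * b * n * t i"
        by (simp add: power_mult_distrib)
      moreover have "n * x = d i"
        using \<open>0 < n\<close> by (simp add: x_def)
      ultimately show ?thesis
        using assms(6) by (simp add: field_simps)
    qed
    hence "(\<Sum>i\<in>V - B. (d i)^2) \<le> 2 * b * n / L * (\<Sum>i\<in>V - B. t i)"
      unfolding sum_distrib_left by (rule sum_mono)
    also have "\<dots> \<le> 2 * b * n / L * T"
      using assms(5,6) \<open>0 < n\<close> \<open>B \<subseteq> V\<close> t unfolding T
      by (intro mult_left_mono) (auto intro!: sum_nonneg)
    finally show ?thesis
      by (simp add: d_def)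
  qed
qed

lemma sum_ordered_pairs:
  fixes f :: "nat \<Rightarrow> nat \<Rightarrow> real"
  assumes "\<And>i j. i \<in> {1..n} \<Longrightarrow> j \<in> {1..n} \<Longrightarrow> f i j = f j i" "\<And>i. i \<in> {1..n} \<Longrightarrow> f i i = 0"
  shows "(\<Sum>i\<in>{1..n}. \<Sum>j\<in>{1..n}. f i j) = 2 * (\<Sum>(i, j) \<in> {(i, j). 1 \<le> i \<and> i < j \<and> j \<le> n}. f i j)"
proof -
  let ?A = "{(i, j). 1 \<le> i \<and> i < j \<and> j \<le> n}"
  let ?B = "{(i, j). 1 \<le> j \<and> j < i \<and> i \<le> n}"
  let ?D = "{(i, j). 1 \<le> i \<and> i = j \<and> j \<le> n}"
  have "finite ?A" "finite ?B" "finite ?D"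
    by (rule finite_subset[of _ "{1..n} \<times> {1..n}"]; force)+
  have "(\<Sum>i\<in>{1..n}. \<Sum>j\<in>{1..n}. f i j) = (\<Sum>(i, j)\<in>{1..n} \<times> {1..n}. f i j)"
    by (rule sum.cartesian_product)
  also have "{1..n} \<times> {1..n} = ?A \<union> (?B \<union> ?D)"
    by auto
  also have "(\<Sum>(i, j)\<in>\<dots>. f i j) = (\<Sum>(i, j)\<in>?A. f i j) + ((\<Sum>(i, j)\<in>?B. f i j) + (\<Sum>(i, j)\<in>?D. f i j))"
    using \<open>finite ?A\<close> \<open>finite ?B\<close> \<open>finite ?D\<close>
    by (subst sum.union_disjoint sum.union_disjoint[of ?B]; (auto; fail)?)+
  also have "(\<Sum>(i, j)\<in>?D. f i j) = 0"
    using assms(2) by (intro sum.neutral) auto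
  also have "(\<Sum>(i, j)\<in>?B. f i j) = (\<Sum>(i, j)\<in>?A. f i j)"
    using assms(1) by (intro sum.reindex_bij_witness[of _ prod.swap prod.swap]) auto
  finally show ?thesis
    by simp
qed

section \<open>Lower bound\<close>

lemma filterlim_ln_inverse_at_right_0: "filterlim (\<lambda>p::real. ln (1 / p)) at_top (at_right 0)"
  using filterlim_compose[OF ln_at_top filterlim_inverse_at_top_right]
  by (simp add: divide_inverse)

lemma tendsto_times_ln_inverse_at_right_0: "((\<lambda>p::real. p * ln (1 / p)) \<longlongrightarrow> 0) (at_right 0)"
proof (rule Lim_transform_eventually)
  show "((\<lambda>p::real. ln (1 / p) ^ 1 / exp (ln (1 / p))) \<longlongrightarrow> 0) (at_right 0)"
    by (rule filterlim_compose[OF tendsto_power_div_exp_0 filterlim_ln_inverse_at_right_0])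
  show "\<forall>\<^sub>F p::real in at_right 0. ln (1 / p) ^ 1 / exp (ln (1 / p)) = p * ln (1 / p)"
    by (rule eventually_mono[OF eventually_at_right_less]) simp
qed

text \<open>Raising every entry to \<open>max (g i j) p = p + u i j\<close> cannot decrease the
  triangle sum. On the diagonal \<open>u\<close> is 0, so the sum over ordered pairs is exactly
  twice that over \<open>i < j\<close>.\<close>

lemma excess_bounds:
  fixes g :: "nat \<Rightarrow> nat \<Rightarrow> real"
  assumes "g \<in> weighted_graphs n" "0 < p" "p < 1"
  defines "u \<equiv> \<lambda>i j. max (g i j - p) 0"
  shows "(\<Sum>i\<in>{1..n}. \<Sum>j\<in>{1..n}. poisson_entropy p (u i j)) \<le> 2 * graph_entropy n p g"
    and "real n ^ 3 * triangle_density n g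
           \<le> (\<Sum>i\<in>{1..n}. \<Sum>j\<in>{1..n}. \<Sum>k\<in>{1..n}. (p + u i j) * (p + u j k) * (p + u i k))"
proof -
  have "(\<Sum>i\<in>{1..n}. \<Sum>j\<in>{1..n}. poisson_entropy p (u i j))
      = 2 * (\<Sum>(i, j) \<in> {(i, j). 1 \<le> i \<and> i < j \<and> j \<le> n}. poisson_entropy p (u i j))"
    using assms(1,2) by (intro sum_ordered_pairs) (auto simp: weighted_graphs_def u_def)
  also have "\<dots> \<le> 2 * graph_entropy n p g"
    unfolding graph_entropy_def using assms(1-3)
    by (intro mult_left_mono sum_mono)
       (auto simp: weighted_graphs_def u_def intro!: rel_entropy_ge_poisson_entropy)
  finally show "(\<Sum>i\<in>{1..n}. \<Sum>j\<in>{1..n}. poisson_entropy p (u i j)) \<le> 2 * graph_entropy n p g" .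
  have "real n ^ 3 * triangle_density n g = (\<Sum>i\<in>{1..n}. \<Sum>j\<in>{1..n}. \<Sum>k\<in>{1..n}. g i j * g j k * g i k)"
    by (cases "n = 0") (auto simp: triangle_density_def)
  also have "\<dots> \<le> (\<Sum>i\<in>{1..n}. \<Sum>j\<in>{1..n}. \<Sum>k\<in>{1..n}. (p + u i j) * (p + u j k) * (p + u i k))"
    using assms(1,2)
    by (intro sum_mono mult_mono mult_nonneg_nonneg) (auto simp: weighted_graphs_def u_def)
  finally show "real n ^ 3 * triangle_density n g \<le> \<dots>" .
qed

text \<open>The numbers \<open>x\<close> and \<open>y\<close> are the rescaled energies \<open>\<Sum>u\<^sub>i\<^sub>j\<^sup>2 / (n p)\<^sup>2\<close> of the excess \<open>u = (g - p)\<^sup>+\<close> between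
  heavy and light vertices (hub part) and among light vertices (clique part), where a vertex is heavy
  if its excess degree is at least \<open>b n\<close>. The four extra terms in the bound for \<open>\<delta>\<close> are, in order, the
  contributions of the edge count, of the degrees of light vertices, of edges inside the heavy set,
  and of excess triangles that touch the heavy set.\<close>
lemma clique_hub_decomposition:
  fixes g :: "nat \<Rightarrow> nat \<Rightarrow> real"
  assumes g: "n \<ge> 1" "g \<in> weighted_graphs n" "(1 + \<delta>) * p^3 \<le> triangle_density n g"
    and p: "0 < p" "p < 1"
    and C: "0 < C" "graph_entropy n p g \<le> C * (real n ^ 2 * p ^ 2 * ln (1 / p))"
    and b: "0 < b" "2 * (1 - ln b) \<le> ln (1 / p)"
    and \<epsilon>: "0 < \<epsilon>" "2 * C * (p * ln (1 / p)) < \<epsilon>^2 / (2 + \<epsilon>)"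
    and \<kappa>: "1 \<le> \<kappa> * ln (1 / p)" "\<kappa> \<le> 1"
  shows "\<exists>x y. 0 \<le> x \<and> 0 \<le> y
    \<and> \<delta> \<le> y powr (3/2) + 3 * x + 3 * \<epsilon> + 12 * b * C + 48 * C^2 * p^2 / b^2 + 12 * C * \<epsilon> / b
    \<and> (1 - \<kappa>) * (x + y / 2) * (real n ^ 2 * p ^ 2 * ln (1 / p)) \<le> graph_entropy n p g
    \<and> (4 * C * (real n * p^2) < b \<longrightarrow> x = 0)"
proof -
  define V where "V = {1..n}"
  define u where "u i j = max (g i j - p) 0" for i j
  define N where "N = real n"
  define L where "L = ln (1 / p)"
  define I where "I = graph_entropy n p g"
  define S where "S = (\<Sum>i\<in>V. \<Sum>j\<in>V. u i j)"
  define T where "T = (\<Sum>i\<in>V. \<Sum>j\<in>V. poisson_entropy p (u i j))"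
  define B where "B = {i \<in> V. b * N \<le> (\<Sum>j\<in>V. u i j)}"
  define \<Delta> where "\<Delta> = (\<Sum>i\<in>V - B. \<Sum>j\<in>V - B. (u i j)^2)"
  define \<Theta> where "\<Theta> = (\<Sum>i\<in>B. \<Sum>j\<in>V - B. (u i j)^2)"
  have V: "finite V" "V \<noteq> {}" "real (card V) = N" "B \<subseteq> V"
    using g(1) by (auto simp: V_def N_def B_def)
  have "0 < N" "0 < L"
    using g(1) p by (auto simp: N_def L_def)
  have u: "0 \<le> u i j" "u i j \<le> 1" "u i j = u j i" if "i \<in> V" "j \<in> V" for i j
  proof -
    have "g i j \<le> 1" "g i j = g j i"
      using that g(2) unfolding V_def weighted_graphs_def by blast+
    thus "0 \<le> u i j" "u i j \<le> 1" "u i j = u j i"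
      using p by (auto simp: u_def)
  qed
  have "T \<le> 2 * I"
    unfolding T_def I_def V_def u_def using excess_bounds(1)[OF g(2) p] .
  hence T: "T \<le> 2 * C * (N^2 * p^2 * L)"
    using C(2) by (simp add: I_def N_def L_def)

  \<comment> \<open>The hypothesis on \<open>b\<close> says exactly that
    \<open>L / 2 \<le> L + ln b - 1\<close>.\<close>
  have Fb: "b * L / 2 \<le> poisson_entropy p b"
  proof -
    have "b * (L / 2) \<le> b * (L + ln b - 1)"
      using b by (intro mult_left_mono) (auto simp: L_def)
    also have "\<dots> \<le> poisson_entropy p b"
      unfolding L_def using p(1) b(1) by (rule poisson_entropy_ge_ln)
    finally show ?thesis
      by simp
  qed
  have rows: "real (card B) * b * L * N \<le> 2 * T"
    "(\<Sum>i\<in>V - B. (\<Sum>j\<in>V. u i j)^2) \<le> 2 * b * N * T / L"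
    using heavy_rows[of V u p b L, unfolded V(3), folded B_def T_def] V u p b \<open>0 < L\<close> Fb by blast+

  have B: "real (card B) \<le> 4 * C * N * p^2 / b"
  proof -
    have "real (card B) * b * L * N \<le> (4 * C * N * p^2) * L * N"
      using rows(1) T by (simp add: power2_eq_square algebra_simps)
    hence "real (card B) * b \<le> 4 * C * N * p^2"
      using \<open>0 < L\<close> \<open>0 < N\<close> by (simp only: mult_le_cancel_right_pos)
    thus ?thesis
      using b(1) by (simp add: field_simps)
  qed
  have light: "(\<Sum>i\<in>V - B. (\<Sum>j\<in>V. u i j)^2) \<le> 4 * b * C * N^3 * p^2"
  proof -
    have "2 * b * N * T / L \<le> 2 * b * N * (2 * C * (N^2 * p^2 * L)) / L"
      using T b(1) \<open>0 < L\<close> \<open>0 < N\<close> by (intro divide_right_mono mult_left_mono) auto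
    also have "\<dots> = 4 * b * C * N^3 * p^2"
      using \<open>0 < L\<close> by (simp add: power2_eq_square power3_eq_cube)
    finally show ?thesis
      using rows(2) by linarith
  qed
  have "0 \<le> S"
    unfolding S_def using u by (intro sum_nonneg) auto
  \<comment> \<open>Jensen over all \<open>N^2\<close> ordered pairs: an average excess above
    \<open>\<epsilon> * p\<close> would cost at least
    \<open>N^2 * p * \<epsilon>^2 / (2 + \<epsilon>)\<close>, more than the available
    \<open>2 * C * N^2 * p^2 * L\<close> because \<open>p * L\<close> is small.\<close>
  have S: "S \<le> \<epsilon> * N^2 * p"
  proof (rule ccontr)
    assume "\<not> S \<le> \<epsilon> * N^2 * p"
    hence "\<epsilon> * p \<le> S / N^2"
      using \<open>0 < N\<close> by (simp add: field_simps)
    have "2 * p + \<epsilon> * p = p * (2 + \<epsilon>)"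
      by (simp add: algebra_simps)
    hence "p * (\<epsilon>^2 / (2 + \<epsilon>)) = (\<epsilon> * p)^2 / (2 * p + \<epsilon> * p)"
      using p by (simp add: power2_eq_square)
    also have "\<dots> \<le> poisson_entropy p (\<epsilon> * p)"
      using p \<epsilon>(1) by (intro poisson_entropy_ge_rational) auto
    also have "\<dots> \<le> poisson_entropy p (S / N^2)"
      using p \<epsilon>(1) \<open>\<epsilon> * p \<le> S / N^2\<close> by (intro poisson_entropy_mono) auto
    finally have "N^2 * (p * (\<epsilon>^2 / (2 + \<epsilon>))) \<le> N^2 * poisson_entropy p (S / N^2)"
      by (intro mult_left_mono) auto
    also have "N^2 * poisson_entropy p (S / N^2) \<le> T"
      using poisson_entropy_jensen[of "V \<times> V" p "\<lambda>(i, j). u i j"] V p u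
      by (auto simp: T_def S_def sum.cartesian_product card_cartesian_product power2_eq_square
            case_prod_unfold)
    also note T
    also have "2 * C * (N^2 * p^2 * L) = N^2 * (p * (2 * C * (p * L)))"
      by (simp add: power2_eq_square)
    finally have "\<epsilon>^2 / (2 + \<epsilon>) \<le> 2 * C * (p * L)"
      using \<open>0 < N\<close> p by (simp only: mult_le_cancel_left_pos zero_less_power)
    with \<epsilon>(2) show False
      by (simp add: L_def)
  qed

  have "0 \<le> \<Delta>" "0 \<le> \<Theta>"
    unfolding \<Delta>_def \<Theta>_def by (intro sum_nonneg; simp)+
  \<comment> \<open>As \<open>u i j \<le> 1\<close>, comparison with the value at 1 gives
    \<open>u^2 * poisson_entropy p 1\<close>, and that value is at least \<open>L - 1\<close>, hence
    at least \<open>(1 - \<kappa>) * L\<close>.\<close>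
  have entropy: "(1 - \<kappa>) * L * (\<Delta> + 2 * \<Theta>) \<le> 2 * I"
  proof -
    have "(1 - \<kappa>) * L * (u i j)^2 \<le> poisson_entropy p (u i j)" if "i \<in> V" "j \<in> V" for i j
    proof -
      have "(1 - \<kappa>) * L \<le> poisson_entropy p 1"
        using poisson_entropy_ge_ln[of p 1] p \<kappa>(1) by (simp add: L_def algebra_simps)
      hence "(u i j)^2 * ((1 - \<kappa>) * L) \<le> (u i j)^2 * poisson_entropy p 1"
        by (intro mult_left_mono) auto
      also have "\<dots> \<le> poisson_entropy p (u i j)"
        using poisson_entropy_over_square_antimono[of p "u i j" 1] p u[of i j] that by simp
      finally show ?thesis
        by (simp add: mult_ac)
    qed
    hence "(1 - \<kappa>) * L * (\<Sum>i\<in>V. \<Sum>j\<in>V. (u i j)^2) \<le> T"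
      unfolding T_def sum_distrib_left by (intro sum_mono)
    \<comment> \<open>The hub part counts twice, once for each order of the heavy and the light
      vertex; the block inside \<open>B\<close> is dropped.\<close>
    moreover have "\<Delta> + 2 * \<Theta> \<le> (\<Sum>i\<in>V. \<Sum>j\<in>V. (u i j)^2)"
    proof -
      have "(\<Sum>i\<in>V - B. \<Sum>j\<in>B. (u i j)^2) = (\<Sum>j\<in>B. \<Sum>i\<in>V - B. (u i j)^2)"
        by (rule sum.swap)
      also have "\<dots> = \<Theta>"
        unfolding \<Theta>_def using u(3) V(4) by (intro sum.cong refl) auto
      finally have "(\<Sum>i\<in>V - B. \<Sum>j\<in>B. (u i j)^2) = \<Theta>" .
      moreover have "0 \<le> (\<Sum>i\<in>B. \<Sum>j\<in>B. (u i j)^2)"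
        by (intro sum_nonneg) auto
      ultimately show ?thesis
        by (simp add: sum_sum_split[OF V(1,4)] \<Delta>_def \<Theta>_def)
    qed
    hence "(1 - \<kappa>) * L * (\<Delta> + 2 * \<Theta>) \<le> (1 - \<kappa>) * L * (\<Sum>i\<in>V. \<Sum>j\<in>V. (u i j)^2)"
      using \<kappa>(2) \<open>0 < L\<close> by (intro mult_left_mono) auto
    ultimately show ?thesis
      using \<open>T \<le> 2 * I\<close> by linarith
  qed

  define M where "M = N * p"
  have "0 < M"
    using \<open>0 < N\<close> p by (simp add: M_def)
  define x where "x = \<Theta> / M^2"
  define y where "y = \<Delta> / M^2"
  have x: "\<Theta> = x * M^2" and y: "\<Delta> = y * M^2"
    using \<open>0 < M\<close> by (auto simp: x_def y_def)
  have "0 \<le> x" "0 \<le> y"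
    using \<open>0 \<le> \<Delta>\<close> \<open>0 \<le> \<Theta>\<close> by (auto simp: x_def y_def)
  have "\<Delta> powr (3/2) = y powr (3/2) * M^3"
  proof -
    have "(M^2) powr (3/2) = M^3"
      using \<open>0 < M\<close> powr_powr[of M 2 "3/2"] by simp
    thus ?thesis
      using \<open>0 \<le> y\<close> by (simp add: y powr_mult)
  qed
  have "(1 + \<delta>) * M^3 \<le> N^3 * triangle_density n g"
    using mult_left_mono[OF g(3), of "N^3"] \<open>0 < N\<close> by (simp add: M_def power_mult_distrib mult_ac)
  also have "\<dots> \<le> (\<Sum>i\<in>V. \<Sum>j\<in>V. \<Sum>k\<in>V. (p + u i j) * (p + u j k) * (p + u i k))"
    unfolding N_def V_def u_def using excess_bounds(2)[OF g(2) p] .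
  also have "\<dots> = M^3 + 3 * p^2 * N * S + 3 * p * (\<Sum>i\<in>V. (\<Sum>j\<in>V. u i j)^2)
      + (\<Sum>i\<in>V. \<Sum>j\<in>V. \<Sum>k\<in>V. u i j * u j k * u i k)"
    by (simp add: sum_shifted_triangles[OF u(3)] V(3) S_def M_def power_mult_distrib)
  \<comment> \<open>Two main terms survive at scale \<open>M^3\<close>:
    \<open>3 * p * N * x * M^2 = 3 * x * M^3\<close> from the degrees of heavy vertices and
    \<open>y powr (3/2) * M^3\<close> from triangles among light ones.\<close>
  also have "\<dots> \<le> M^3 + 3 * p^2 * N * (\<epsilon> * N^2 * p)
      + 3 * p * (4 * b * C * N^3 * p^2 + N * (x * M^2 + (4 * C * N * p^2 / b)^2))
      + (y powr (3/2) * M^3 + 3 * (4 * C * N * p^2 / b) * (\<epsilon> * N^2 * p))"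
  proof (intro add_mono mult_left_mono order_refl)
    show "S \<le> \<epsilon> * N^2 * p"
      by (rule S)
    have "(\<Sum>i\<in>V. (\<Sum>j\<in>V. u i j)^2) = (\<Sum>i\<in>V - B. (\<Sum>j\<in>V. u i j)^2) + (\<Sum>i\<in>B. (\<Sum>j\<in>V. u i j)^2)"
      using V(1,4) by (rule sum.subset_diff[rotated])
    also have "(\<Sum>i\<in>B. (\<Sum>j\<in>V. u i j)^2) \<le> N * (\<Theta> + real (card B)^2)"
      unfolding \<Theta>_def V(3)[symmetric] using V(1,4) u by (intro sum_heavy_degree_squares_le) auto
    also have "\<dots> \<le> N * (x * M^2 + (4 * C * N * p^2 / b)^2)"
      unfolding x using B \<open>0 < N\<close> by (intro mult_left_mono add_left_mono power_mono) auto
    finally show "(\<Sum>i\<in>V. (\<Sum>j\<in>V. u i j)^2)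
        \<le> 4 * b * C * N^3 * p^2 + N * (x * M^2 + (4 * C * N * p^2 / b)^2)"
      using light by linarith
    have "(\<Sum>i\<in>V. \<Sum>j\<in>V. \<Sum>k\<in>V. u i j * u j k * u i k) \<le> \<Delta> powr (3/2) + 3 * real (card B) * S"
      unfolding \<Delta>_def S_def using V(1,4) u by (intro sum_triangles_le_remove) auto
    also have "3 * real (card B) * S \<le> 3 * (4 * C * N * p^2 / b) * (\<epsilon> * N^2 * p)"
      using B S \<open>0 \<le> S\<close> C(1) b(1) \<open>0 < N\<close> by (intro mult_mono) auto
    finally show "(\<Sum>i\<in>V. \<Sum>j\<in>V. \<Sum>k\<in>V. u i j * u j k * u i k)
        \<le> y powr (3/2) * M^3 + 3 * (4 * C * N * p^2 / b) * (\<epsilon> * N^2 * p)"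
      using \<open>\<Delta> powr (3/2) = y powr (3/2) * M^3\<close> by simp
  qed (use p \<open>0 < N\<close> in auto)
  also have "\<dots> = (1 + y powr (3/2) + 3 * x + 3 * \<epsilon> + 12 * b * C + 48 * C^2 * p^2 / b^2 + 12 * C * \<epsilon> / b) * M^3"
    using b(1) by (simp add: M_def field_simps power2_eq_square power3_eq_cube)
  finally have "\<delta> \<le> y powr (3/2) + 3 * x + 3 * \<epsilon> + 12 * b * C + 48 * C^2 * p^2 / b^2 + 12 * C * \<epsilon> / b"
    using \<open>0 < M\<close> by simp
  moreover have "(1 - \<kappa>) * (x + y / 2) * (N^2 * p^2 * L) \<le> I"
    using entropy by (simp add: x y M_def field_simps)
  \<comment> \<open>The bound on \<open>card B\<close> is below 1 here, and a cardinality below 1 is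
    0.\<close>
  moreover have "x = 0" if "4 * C * (N * p^2) < b"
  proof -
    have "4 * C * N * p^2 / b < 1"
      using that b(1) by (simp add: mult_ac)
    with B have "card B = 0"
      by linarith
    hence "B = {}"
      using finite_subset[OF V(4,1)] by simp
    thus ?thesis
      by (simp add: x_def \<Theta>_def)
  qed
  ultimately show ?thesis
    using \<open>0 \<le> x\<close> \<open>0 \<le> y\<close> unfolding N_def L_def I_def by blast
qed

section \<open>Minimizing the rescaled cost and choosing the error constants\<close>

lemma powr_two_thirds_le:
  fixes d y :: real
  assumes "0 \<le> d" "0 \<le> y" "d \<le> y powr (3/2)"
  shows "d powr (2/3) \<le> y"
proof -
  have "d powr (2/3) \<le> (y powr (3/2)) powr (2/3)"
    using assms by (intro powr_mono2) auto
  also have "\<dots> = y"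
    using assms by (simp add: powr_powr)
  finally show ?thesis .
qed

text \<open>Let \<open>r = d powr (1/3)\<close>. If \<open>y \<ge> r^2\<close>, the clique cost
  alone is enough. Otherwise replace \<open>y powr (3/2)\<close> by its chord \<open>y * r\<close>
  on \<open>[0, r^2]\<close>: the resulting lower bound is linear in \<open>y\<close>, so its
  minimum is at an endpoint, \<open>r^3 / 3\<close> at 0 or \<open>r^2 / 2\<close> at
  \<open>r^2\<close>. The slope changes sign at \<open>r = 3/2\<close>.\<close>

lemma clique_hub_minimum:
  fixes d x y :: real
  assumes "0 \<le> d" "0 \<le> x" "0 \<le> y" "d \<le> y powr (3/2) + 3 * x"
  shows "min (d powr (2/3) / 2) (d / 3) \<le> x + y / 2"
proof -
  define r where "r = d powr (1/3)"
  have "0 \<le> r"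
    by (simp add: r_def)
  have r2: "r^2 = d powr (2/3)" and r3: "r^3 = d"
  proof -
    have "r^2 = d powr (1/3 + 1/3)" "r^3 = d powr (1/3 + 1/3 + 1/3)"
      by (simp_all only: r_def power2_eq_square power3_eq_cube powr_add)
    thus "r^2 = d powr (2/3)" "r^3 = d"
      using assms(1) by simp_all
  qed
  show ?thesis
  proof (cases "r^2 \<le> y")
    case True
    thus ?thesis
      using assms(2) r2 by (auto simp: min_def)
  next
    case False
    have "y powr (3/2) = y powr (1 + 1/2)"
      by simp
    also have "\<dots> = y * sqrt y"
      using assms(3) by (simp only: powr_add) (simp add: powr_half_sqrt)
    also have "\<dots> \<le> y * r"
      using False \<open>0 \<le> r\<close> assms(3) by (intro mult_left_mono real_le_lsqrt) auto
    finally have "r^3 / 3 + y * (1/2 - r / 3) \<le> x + y / 2"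
      using assms(4) r3 by (simp add: algebra_simps)
    moreover have "min (r^2 / 2) (r^3 / 3) \<le> r^3 / 3 + y * (1/2 - r / 3)"
    proof (cases "r \<le> 3/2")
      case True
      hence "0 \<le> y * (1/2 - r / 3)"
        using assms(3) by simp
      thus ?thesis
        by linarith
    next
      case False
      hence "r^2 * (1/2 - r / 3) \<le> y * (1/2 - r / 3)"
        using \<open>\<not> r^2 \<le> y\<close> by (intro mult_right_mono_neg) auto
      moreover have "r^2 / 2 = r^3 / 3 + r^2 * (1/2 - r / 3)"
        by (simp add: algebra_simps power2_eq_square power3_eq_cube)
      ultimately show ?thesis
        by linarith
    qed
    ultimately show ?thesis
      unfolding r2 r3 by linarith
  qed
qed

text \<open>How small \<open>p\<close> must be does not depend on \<open>n\<close> or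
  \<open>g\<close>, so the bound survives the infimum over graphs and composition with any
  \<open>p n\<close> tending to 0 from the right. The second conjunct serves the regime in which
  \<open>n * p^2\<close> tends to 0.\<close>

lemma eventually_graph_entropy_ge:
  fixes \<delta> \<eta> :: real
  assumes "0 < \<delta>" "0 < \<eta>"
  obtains c where "0 < c"
    "\<forall>\<^sub>F p in at_right 0. \<forall>n g. n \<ge> 1 \<longrightarrow> g \<in> weighted_graphs n \<longrightarrow> (1 + \<delta>) * p^3 \<le> triangle_density n g \<longrightarrow>
       (min (\<delta> powr (2/3) / 2) (\<delta> / 3) - \<eta>) * (real n ^ 2 * p ^ 2 * ln (1 / p)) \<le> graph_entropy n p g \<and>
       (real n * p^2 < c \<longrightarrow>
         (\<delta> powr (2/3) / 2 - \<eta>) * (real n ^ 2 * p ^ 2 * ln (1 / p)) \<le> graph_entropy n p g)"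
proof -
  define m1 where "m1 d = min (d powr (2/3) / 2) (d / 3)" for d :: real
  define m2 where "m2 d = d powr (2/3) / 2" for d :: real
  \<comment> \<open>A graph costing more than \<open>C * D\<close> satisfies both bounds trivially,
    so the decomposition is needed only below this threshold.\<close>
  define C where "C = m2 \<delta> + 1"
  have "0 < C" "m1 \<delta> - \<eta> \<le> C" "m2 \<delta> - \<eta> \<le> C"
    using assms by (auto simp: C_def m1_def m2_def intro: add_nonneg_pos)
  \<comment> \<open>\<open>\<kappa>\<close> bounds both the relative loss in the entropy and the
    total error subtracted from \<open>\<delta>\<close>; it exists by continuity at 0.\<close>
  obtain \<kappa> where \<kappa>: "0 < \<kappa>" "\<kappa> < 1" "\<kappa> < \<delta>" "m1 \<delta> - \<eta> < (1 - \<kappa>) * m1 (\<delta> - \<kappa>)"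
    "m2 \<delta> - \<eta> < (1 - \<kappa>) * m2 (\<delta> - \<kappa>)"
  proof -
    have m2: "((\<lambda>\<kappa>. m2 (\<delta> - \<kappa>)) \<longlongrightarrow> m2 \<delta>) (at_right 0)"
      unfolding m2_def using assms by (auto intro!: tendsto_eq_intros)
    have "((\<lambda>\<kappa>. m1 (\<delta> - \<kappa>)) \<longlongrightarrow> m1 \<delta>) (at_right 0)"
      unfolding m1_def using m2[unfolded m2_def] by (intro tendsto_min) (auto intro!: tendsto_eq_intros)
    hence "((\<lambda>\<kappa>. (1 - \<kappa>) * m1 (\<delta> - \<kappa>)) \<longlongrightarrow> (1 - 0) * m1 \<delta>) (at_right 0)"
      by (intro tendsto_intros)
    hence 1: "\<forall>\<^sub>F \<kappa> in at_right 0. m1 \<delta> - \<eta> < (1 - \<kappa>) * m1 (\<delta> - \<kappa>)"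
      using assms by (intro order_tendstoD(1)) auto
    have "((\<lambda>\<kappa>. (1 - \<kappa>) * m2 (\<delta> - \<kappa>)) \<longlongrightarrow> (1 - 0) * m2 \<delta>) (at_right 0)"
      using m2 by (intro tendsto_intros)
    hence 2: "\<forall>\<^sub>F \<kappa> in at_right 0. m2 \<delta> - \<eta> < (1 - \<kappa>) * m2 (\<delta> - \<kappa>)"
      using assms by (intro order_tendstoD(1)) auto
    have 3: "\<forall>\<^sub>F \<kappa> in at_right 0. \<kappa> \<in> {0<..<min 1 \<delta>}"
      using assms by (intro eventually_at_right_real) auto
    from 1 2 3 have "\<forall>\<^sub>F \<kappa> in at_right 0. 0 < \<kappa> \<and> \<kappa> < 1 \<and> \<kappa> < \<delta> \<and>
        m1 \<delta> - \<eta> < (1 - \<kappa>) * m1 (\<delta> - \<kappa>) \<and> m2 \<delta> - \<eta> < (1 - \<kappa>) * m2 (\<delta> - \<kappa>)"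
      by eventually_elim auto
    from eventually_happens'[OF _ this] show ?thesis
      using that by auto
  qed
  \<comment> \<open>The sizes keep three of the four error terms below \<open>\<kappa> / 4\<close>.
    One of them contains \<open>\<epsilon> / b\<close>, so \<open>\<epsilon>\<close> is chosen after
    \<open>b\<close>. The fourth term contains \<open>p^2\<close> and is made small by
    \<open>p\<close>.\<close>
  define b where "b = min 1 (\<kappa> / (48 * C))"
  define \<epsilon> where "\<epsilon> = min (\<kappa> / 12) (\<kappa> * b / (48 * C))"
  have "0 < b" "0 < \<epsilon>"
    using \<kappa> \<open>0 < C\<close> by (auto simp: b_def \<epsilon>_def)
  have err: "12 * b * C \<le> \<kappa> / 4" "3 * \<epsilon> \<le> \<kappa> / 4" "12 * C * \<epsilon> / b \<le> \<kappa> / 4"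
  proof -
    have "b \<le> \<kappa> / (48 * C)" "\<epsilon> \<le> \<kappa> * b / (48 * C)" "\<epsilon> \<le> \<kappa> / 12"
      by (auto simp: b_def \<epsilon>_def)
    thus "12 * b * C \<le> \<kappa> / 4" "3 * \<epsilon> \<le> \<kappa> / 4" "12 * C * \<epsilon> / b \<le> \<kappa> / 4"
      using \<open>0 < C\<close> \<open>0 < b\<close> by (simp_all add: field_simps)
  qed
  show ?thesis
  proof (rule that)
    show "0 < b / (4 * C)"
      using \<open>0 < b\<close> \<open>0 < C\<close> by simp
    have "\<forall>\<^sub>F p::real in at_right 0. p \<in> {0<..<1}"
      by (intro eventually_at_right_real) auto
    moreover have "\<forall>\<^sub>F p in at_right 0. max (2 * (1 - ln b)) (1 / \<kappa>) \<le> ln (1 / p)"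
      using filterlim_ln_inverse_at_right_0 unfolding filterlim_at_top by blast
    moreover have "\<forall>\<^sub>F p in at_right 0. p * ln (1 / p) < \<epsilon>^2 / (2 + \<epsilon>) / (2 * C)"
      using \<open>0 < \<epsilon>\<close> \<open>0 < C\<close> by (intro order_tendstoD(2)[OF tendsto_times_ln_inverse_at_right_0]) auto
    moreover have "\<forall>\<^sub>F p in at_right 0. 48 * C^2 * p^2 / b^2 < \<kappa> / 4"
      using \<kappa>(1) \<open>0 < b\<close> by (intro order_tendstoD(2)[of _ 0]) (auto intro!: tendsto_eq_intros)
    ultimately show "\<forall>\<^sub>F p in at_right 0. \<forall>n g. n \<ge> 1 \<longrightarrow> g \<in> weighted_graphs n \<longrightarrow>
       (1 + \<delta>) * p^3 \<le> triangle_density n g \<longrightarrow>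
       (min (\<delta> powr (2/3) / 2) (\<delta> / 3) - \<eta>) * (real n ^ 2 * p ^ 2 * ln (1 / p)) \<le> graph_entropy n p g \<and>
       (real n * p^2 < b / (4 * C) \<longrightarrow>
         (\<delta> powr (2/3) / 2 - \<eta>) * (real n ^ 2 * p ^ 2 * ln (1 / p)) \<le> graph_entropy n p g)"
    proof eventually_elim
      case (elim p)
      show ?case
      proof (intro allI impI)
        fix n :: nat and g
        assume g: "n \<ge> 1" "g \<in> weighted_graphs n" "(1 + \<delta>) * p^3 \<le> triangle_density n g"
        define D where "D = real n ^ 2 * p ^ 2 * ln (1 / p)"
        have "0 \<le> D"
          using elim by (auto simp: D_def)
        have "(m1 \<delta> - \<eta>) * D \<le> graph_entropy n p g \<and>
          (real n * p^2 < b / (4 * C) \<longrightarrow> (m2 \<delta> - \<eta>) * D \<le> graph_entropy n p g)"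
        proof (cases "graph_entropy n p g \<le> C * D")
          case False
          thus ?thesis
            using \<open>0 \<le> D\<close> \<open>m1 \<delta> - \<eta> \<le> C\<close> \<open>m2 \<delta> - \<eta> \<le> C\<close>
              mult_right_mono[of "m1 \<delta> - \<eta>" C D] mult_right_mono[of "m2 \<delta> - \<eta>" C D] by auto
        next
          case True
          have "\<exists>x y. 0 \<le> x \<and> 0 \<le> y
            \<and> \<delta> \<le> y powr (3/2) + 3 * x + 3 * \<epsilon> + 12 * b * C + 48 * C^2 * p^2 / b^2 + 12 * C * \<epsilon> / b
            \<and> (1 - \<kappa>) * (x + y / 2) * D \<le> graph_entropy n p g
            \<and> (4 * C * (real n * p^2) < b \<longrightarrow> x = 0)"
            unfolding D_def
          proof (rule clique_hub_decomposition[OF g])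
            show "graph_entropy n p g \<le> C * (real n ^ 2 * p ^ 2 * ln (1 / p))"
              using True by (simp add: D_def)
            show "2 * C * (p * ln (1 / p)) < \<epsilon>^2 / (2 + \<epsilon>)"
              using elim(3) \<open>0 < C\<close> by (subst (asm) pos_less_divide_eq) (auto simp: mult_ac)
            show "1 \<le> \<kappa> * ln (1 / p)"
              using elim(2) \<kappa>(1) by (simp add: field_simps)
          qed (use elim \<kappa> \<open>0 < C\<close> \<open>0 < b\<close> \<open>0 < \<epsilon>\<close> in auto)
          then obtain x y where xy: "0 \<le> x" "0 \<le> y" "\<delta> - \<kappa> \<le> y powr (3/2) + 3 * x"
            "(1 - \<kappa>) * (x + y / 2) * D \<le> graph_entropy n p g"
            "4 * C * (real n * p^2) < b \<Longrightarrow> x = 0"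
            using err elim(4) by force
          have mono: "(m - \<eta>) * D \<le> graph_entropy n p g"
            if "m - \<eta> < (1 - \<kappa>) * m'" "m' \<le> x + y / 2" for m m'
          proof -
            have "(1 - \<kappa>) * m' \<le> (1 - \<kappa>) * (x + y / 2)"
              using that(2) \<kappa>(2) by (intro mult_left_mono) auto
            hence "(m - \<eta>) * D \<le> (1 - \<kappa>) * (x + y / 2) * D"
              using that(1) \<open>0 \<le> D\<close> by (intro mult_right_mono) auto
            with xy(4) show ?thesis
              by simp
          qed
          show ?thesis
          proof (intro conjI impI)
            show "(m1 \<delta> - \<eta>) * D \<le> graph_entropy n p g"
              using xy(1-3) \<kappa>(3,4) unfolding m1_def[of "\<delta> - \<kappa>"]
              by (intro mono[of _ "m1 (\<delta> - \<kappa>)"]) (auto simp only: m1_def intro!: clique_hub_minimum)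
            assume "real n * p^2 < b / (4 * C)"
            hence "x = 0"
              using \<open>0 < C\<close> by (intro xy(5)) (simp add: field_simps)
            with xy(3) have "(\<delta> - \<kappa>) powr (2/3) \<le> y"
              using xy(2) \<kappa>(3) by (intro powr_two_thirds_le) auto
            thus "(m2 \<delta> - \<eta>) * D \<le> graph_entropy n p g"
              using \<kappa>(5) \<open>x = 0\<close> by (intro mono[of _ "m2 (\<delta> - \<kappa>)"]) (auto simp: m2_def)
          qed
        qed
        thus "(min (\<delta> powr (2/3) / 2) (\<delta> / 3) - \<eta>) * (real n ^ 2 * p ^ 2 * ln (1 / p)) \<le> graph_entropy n p g \<and>
          (real n * p^2 < b / (4 * C) \<longrightarrow>
          (\<delta> powr (2/3) / 2 - \<eta>) * (real n ^ 2 * p ^ 2 * ln (1 / p)) \<le> graph_entropy n p g)"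
          by (simp add: m1_def m2_def D_def)
      qed
    qed
  qed
qed

section \<open>Planted cliques and hubs\<close>

text \<open>In the test graph a pair of weight \<open>p\<close> costs nothing and a pair of weight 1
  costs \<open>ln (1 / p)\<close>. The factor 1/2 turns ordered pairs into edges.\<close>

lemma phi_le_planted:
  fixes E :: "nat \<Rightarrow> nat \<Rightarrow> bool"
  assumes "0 < p" "p < 1" "n \<ge> 1" "\<And>i j. E i j \<Longrightarrow> E j i" "\<And>i. \<not> E i i"
  defines "g \<equiv> \<lambda>i j. if i = j then 0 else if E i j then 1 else p"
  assumes "(1 + \<delta>) * p^3 * real n ^ 3 \<le> (\<Sum>i\<in>{1..n}. \<Sum>j\<in>{1..n}. \<Sum>k\<in>{1..n}. g i j * g j k * g i k)"
  shows "phi n p \<delta> \<le> ereal (ln (1 / p) / 2 * (\<Sum>i\<in>{1..n}. \<Sum>j\<in>{1..n}. of_bool (E i j)))"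
proof -
  have "g \<in> weighted_graphs n"
    using assms(1,2,4) by (auto simp: weighted_graphs_def g_def)
  moreover have "(1 + \<delta>) * p^3 \<le> triangle_density n g"
    using assms(3,7) by (simp add: triangle_density_def field_simps)
  ultimately have "phi n p \<delta> \<le> ereal (graph_entropy n p g)"
    unfolding phi_def by (intro INF_lower) auto
  also have "graph_entropy n p g = (\<Sum>(i, j) \<in> {(i, j). 1 \<le> i \<and> i < j \<and> j \<le> n}. ln (1 / p) * of_bool (E i j))"
    unfolding graph_entropy_def using assms(1,2)
    by (intro sum.cong refl) (auto simp: g_def rel_entropy_def)
  also have "\<dots> = ln (1 / p) / 2 * (\<Sum>i\<in>{1..n}. \<Sum>j\<in>{1..n}. of_bool (E i j))"
    using assms(4,5) by (subst sum_ordered_pairs) (auto simp: sum_distrib_left case_prod_unfold)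
  finally show ?thesis .
qed

text \<open>Union bound over the three possible coincidences, each of which holds for
  \<open>card A ^ 2\<close> triples. Since weights vanish on the diagonal, only distinct triples
  count in the planted graphs.\<close>

lemma sum_distinct_triples_ge:
  assumes "finite A"
  shows "real (card A) ^ 3 - 3 * real (card A) ^ 2
    \<le> (\<Sum>i\<in>A. \<Sum>j\<in>A. \<Sum>k\<in>A. of_bool (i \<noteq> j \<and> j \<noteq> k \<and> i \<noteq> k))"
proof -
  let ?s = "\<lambda>f. \<Sum>i\<in>A. \<Sum>j\<in>A. \<Sum>k\<in>A. (f i j k :: real)"
  have *: "(\<Sum>j\<in>A. of_bool (i = j)) = (1::real)" if "i \<in> A" for i
    using assms that by (simp add: of_bool_def)
  have "?s (\<lambda>i j k. 1 - of_bool (i = j) - of_bool (j = k) - of_bool (i = k))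
      = ?s (\<lambda>i j k. 1) - ?s (\<lambda>i j k. of_bool (i = j)) - ?s (\<lambda>i j k. of_bool (j = k)) - ?s (\<lambda>i j k. of_bool (i = k))"
    by (simp only: sum_subtractf)
  also have "?s (\<lambda>i j k. of_bool (i = j)) = real (card A) ^ 2"
    by (simp add: * power2_eq_square flip: sum_distrib_left)
  also have "?s (\<lambda>i j k. of_bool (j = k)) = real (card A) ^ 2"
    by (simp add: * power2_eq_square)
  also have "?s (\<lambda>i j k. of_bool (i = k)) = real (card A) ^ 2"
    by (simp add: * power2_eq_square)
  also have "?s (\<lambda>i j k. 1) = real (card A) ^ 3"
    by (simp add: power3_eq_cube)
  finally have "real (card A) ^ 3 - 3 * real (card A) ^ 2
      = ?s (\<lambda>i j k. 1 - of_bool (i = j) - of_bool (j = k) - of_bool (i = k))"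
    by simp
  also have "\<dots> \<le> ?s (\<lambda>i j k. of_bool (i \<noteq> j \<and> j \<noteq> k \<and> i \<noteq> k))"
    by (intro sum_mono) auto
  finally show ?thesis .
qed

text \<open>Plant a clique on \<open>a\<close> vertices. Every distinct triple weighs at least
  \<open>p^3\<close>, and those inside the clique gain a further \<open>1 - p^3\<close>.\<close>

lemma phi_le_clique:
  assumes "0 < p" "p < 1" "n \<ge> 1" "a \<le> n"
    and "(1 + \<delta>) * p^3 * real n ^ 3
      \<le> p^3 * (real n ^ 3 - 3 * real n ^ 2) + (1 - p^3) * (real a ^ 3 - 3 * real a ^ 2)"
  shows "phi n p \<delta> \<le> ereal (real a ^ 2 / 2 * ln (1 / p))"
proof -
  let ?E = "\<lambda>i j. i \<in> {1..a} \<and> j \<in> {1..a} \<and> i \<noteq> j"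
  define g where "g i j = (if i = j then 0 else if ?E i j then 1 else p)" for i j
  let ?d = "\<lambda>i j k::nat. of_bool (i \<noteq> j \<and> j \<noteq> k \<and> i \<noteq> k) :: real"
  let ?a = "\<lambda>i j k. of_bool (i \<in> {1..a}) * of_bool (j \<in> {1..a}) * of_bool (k \<in> {1..a}) :: real"
  have "p^3 \<le> 1" "p^3 \<le> p^2" "p^3 \<le> p"
    using assms(1,2) power_decreasing[of 2 3 p] power_decreasing[of 1 3 p]
    by (auto intro: power_le_one)
  hence pt: "p^3 * ?d i j k + (1 - p^3) * (?a i j k * ?d i j k) \<le> g i j * g j k * g i k" for i j k
    using assms(1,2) by (auto simp: g_def power2_eq_square power3_eq_cube)
  have "(1 + \<delta>) * p^3 * real n ^ 3
      \<le> p^3 * (real (card {1..n}) ^ 3 - 3 * real (card {1..n}) ^ 2)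
        + (1 - p^3) * (real (card {1..a}) ^ 3 - 3 * real (card {1..a}) ^ 2)"
    using assms(5) by simp
  also have "\<dots> \<le> p^3 * (\<Sum>i\<in>{1..n}. \<Sum>j\<in>{1..n}. \<Sum>k\<in>{1..n}. ?d i j k)
       + (1 - p^3) * (\<Sum>i\<in>{1..a}. \<Sum>j\<in>{1..a}. \<Sum>k\<in>{1..a}. ?d i j k)"
    using assms(1) \<open>p^3 \<le> 1\<close> by (intro add_mono mult_left_mono sum_distinct_triples_ge) auto
  also have "(\<Sum>i\<in>{1..a}. \<Sum>j\<in>{1..a}. \<Sum>k\<in>{1..a}. ?d i j k)
      = (\<Sum>i\<in>{1..n}. \<Sum>j\<in>{1..n}. \<Sum>k\<in>{1..n}. ?a i j k * ?d i j k)"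
    using assms(4) by (intro sum.mono_neutral_cong_left ballI sum.neutral) auto
  also have "p^3 * (\<Sum>i\<in>{1..n}. \<Sum>j\<in>{1..n}. \<Sum>k\<in>{1..n}. ?d i j k)
      + (1 - p^3) * (\<Sum>i\<in>{1..n}. \<Sum>j\<in>{1..n}. \<Sum>k\<in>{1..n}. ?a i j k * ?d i j k)
      = (\<Sum>i\<in>{1..n}. \<Sum>j\<in>{1..n}. \<Sum>k\<in>{1..n}. p^3 * ?d i j k + (1 - p^3) * (?a i j k * ?d i j k))"
    by (simp only: sum.distrib sum_distrib_left)
  also have "\<dots> \<le> (\<Sum>i\<in>{1..n}. \<Sum>j\<in>{1..n}. \<Sum>k\<in>{1..n}. g i j * g j k * g i k)"
    by (intro sum_mono pt)
  finally have "phi n p \<delta> \<le> ereal (ln (1 / p) / 2 * (\<Sum>i\<in>{1..n}. \<Sum>j\<in>{1..n}. of_bool (?E i j)))"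
    unfolding g_def by (intro phi_le_planted assms) auto
  also have "(\<Sum>i\<in>{1..n}. \<Sum>j\<in>{1..n}. of_bool (?E i j))
      \<le> (\<Sum>i\<in>{1..n}. \<Sum>j\<in>{1..n}. of_bool (i \<in> {1..a}) * of_bool (j \<in> {1..a}) :: real)"
    by (intro sum_mono) auto
  also have "\<dots> = real a ^ 2"
  proof -
    have "(\<Sum>i\<in>{1..n}. of_bool (i \<in> {1..a})) = real a"
      using sum.mono_neutral_cong_right[of "{1..n}" "{1..a}" "\<lambda>i. of_bool (i \<in> {1..a})" "\<lambda>_. 1::real"] assms(4)
      by auto
    thus ?thesis
      by (simp only: power2_eq_square flip: sum_distrib_left sum_distrib_right)
  qed
  finally show ?thesis
    using assms(1,2) by (simp add: mult_left_mono mult_ac)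
qed

text \<open>Join \<open>a\<close> hubs to all other vertices, leaving pairs of hubs at weight
  \<open>p\<close>. A distinct triple with exactly one hub weighs \<open>p\<close>, a gain of
  \<open>p - p^3\<close>; the hub has three possible positions. All other distinct triples are
  bounded below by \<open>p^3\<close>.\<close>

lemma phi_le_hub:
  assumes "0 < p" "p < 1" "n \<ge> 1" "a \<le> n"
    and "(1 + \<delta>) * p^3 * real n ^ 3 \<le> p^3 * (real n ^ 3 - 3 * real n ^ 2)
        + 3 * (p - p^3) * (real a * ((real n - real a) ^ 2 - (real n - real a)))"
  shows "phi n p \<delta> \<le> ereal (real a * real n * ln (1 / p))"
proof -
  let ?A = "{1..a}" and ?V = "{1..n}"
  let ?E = "\<lambda>i j. (i \<in> ?A) \<noteq> (j \<in> ?A)"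
  define g where "g i j = (if i = j then 0 else if ?E i j then 1 else p)" for i j
  let ?s = "\<lambda>f. \<Sum>i\<in>?V. \<Sum>j\<in>?V. \<Sum>k\<in>?V. (f i j k :: real)"
  let ?d = "\<lambda>i j k::nat. of_bool (i \<noteq> j \<and> j \<noteq> k \<and> i \<noteq> k) :: real"
  define b where "b i = (of_bool (i \<in> ?A) :: real)" for i
  define h where "h j k = (of_bool (j \<notin> ?A \<and> k \<notin> ?A \<and> j \<noteq> k) :: real)" for j k
  have "p^3 \<le> 1" "p^3 \<le> p"
    using assms(1,2) power_decreasing[of 1 3 p] by (auto intro: power_le_one)
  hence pt: "p^3 * ?d i j k + (p - p^3) * (b i * h j k + b j * h i k + b k * h i j)
      \<le> g i j * g j k * g i k" for i j k
    using assms(1,2) by (auto simp: g_def b_def h_def power3_eq_cube)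
  have sum_b: "(\<Sum>i\<in>?V. b i) = real a"
    using sum.mono_neutral_cong_right[of ?V ?A b "\<lambda>_. 1"] assms(4) by (auto simp: b_def)
  have sum_h: "(\<Sum>j\<in>?V. \<Sum>k\<in>?V. h j k) = (real n - real a) ^ 2 - (real n - real a)"
  proof -
    define W where "W = ?V - ?A"
    have W: "finite W" "real (card W) = real n - real a"
      using assms(4) by (simp_all add: W_def card_Diff_subset of_nat_diff)
    have "(\<Sum>j\<in>?V. \<Sum>k\<in>?V. h j k) = (\<Sum>j\<in>W. \<Sum>k\<in>W. 1 - of_bool (j = k))"
      unfolding W_def
      by (intro sum.mono_neutral_cong_right ballI sum.neutral) (auto simp: h_def)
    also have "\<dots> = (\<Sum>j\<in>W. (real n - real a) - 1)"
      using W by (intro sum.cong refl) (simp add: sum_subtractf of_bool_def)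
    finally show ?thesis
      using W by (simp add: power2_eq_square algebra_simps)
  qed
  let ?t = "real a * ((real n - real a) ^ 2 - (real n - real a))"
  have t1: "?s (\<lambda>i j k. b i * h j k) = ?t"
    by (simp only: sum_b sum_h flip: sum_distrib_left sum_distrib_right)
  have t2: "?s (\<lambda>i j k. b j * h i k) = ?t"
    by (subst sum.swap) (rule t1)
  have t3: "?s (\<lambda>i j k. b k * h i j) = ?t"
    by (simp only: sum_b sum_h flip: sum_distrib_left sum_distrib_right)
  have "(1 + \<delta>) * p^3 * real n ^ 3
      \<le> p^3 * (real (card ?V) ^ 3 - 3 * real (card ?V) ^ 2) + (p - p^3) * (?t + ?t + ?t)"
  proof -
    have "3 * (p - p^3) * ?t = (p - p^3) * (?t + ?t + ?t)" "real (card ?V) = real n"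
      by (simp_all only: mult.assoc ring_distribs) simp_all
    thus ?thesis
      using assms(5) by (simp only:)
  qed
  also have "\<dots> \<le> p^3 * ?s ?d + (p - p^3) * (?t + ?t + ?t)"
    using assms(1) by (intro add_right_mono mult_left_mono sum_distinct_triples_ge) auto
  also have "\<dots> = p^3 * ?s ?d + (p - p^3) * (?s (\<lambda>i j k. b i * h j k)
      + ?s (\<lambda>i j k. b j * h i k) + ?s (\<lambda>i j k. b k * h i j))"
    unfolding t1 t2 t3 ..
  also have "\<dots> = ?s (\<lambda>i j k. p^3 * ?d i j k + (p - p^3) * (b i * h j k + b j * h i k + b k * h i j))"
    by (simp only: sum.distrib sum_distrib_left distrib_left)
  also have "\<dots> \<le> ?s (\<lambda>i j k. g i j * g j k * g i k)"
    by (intro sum_mono pt)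
  finally have "phi n p \<delta> \<le> ereal (ln (1 / p) / 2 * (\<Sum>i\<in>?V. \<Sum>j\<in>?V. of_bool (?E i j)))"
    unfolding g_def by (intro phi_le_planted assms) auto
  also have "(\<Sum>i\<in>?V. \<Sum>j\<in>?V. of_bool (?E i j)) \<le> (\<Sum>i\<in>?V. \<Sum>j\<in>?V. b i + b j)"
    by (intro sum_mono) (auto simp: b_def)
  also have "\<dots> = 2 * real a * real n"
    by (simp add: sum.distrib sum_b[simplified] flip: sum_distrib_left)
  finally show ?thesis
    using assms(1,2) by (simp add: mult_left_mono mult_ac)
qed

text \<open>The clique has size \<open>s * n * p\<close> rounded up, with \<open>s\<close> slightly
  above \<open>\<delta> powr (1/3)\<close>. The surplus \<open>s^3 - \<delta>\<close> absorbs the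
  losses from coinciding indices, and rounding is negligible as \<open>n * p\<close> tends to
  infinity.\<close>

lemma eventually_phi_le_clique:
  fixes p :: "nat \<Rightarrow> real"
  assumes "0 < \<delta>" "0 < \<eta>" "\<And>n. n \<ge> 1 \<Longrightarrow> 0 < p n \<and> p n < 1"
    and "p \<longlonglongrightarrow> 0" "filterlim (\<lambda>n. real n * p n) at_top sequentially"
  shows "\<forall>\<^sub>F n in sequentially.
    phi n (p n) \<delta> \<le> ereal ((\<delta> powr (2/3) / 2 + \<eta>) * (real n ^ 2 * p n ^ 2 * ln (1 / p n)))"
proof -
  define r where "r = \<delta> powr (1/3)"
  have r: "0 < r" "r^3 = \<delta>" "r^2 = \<delta> powr (2/3)"
  proof -
    have "r^2 = \<delta> powr (1/3 + 1/3)" "r^3 = \<delta> powr (1/3 + 1/3 + 1/3)"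
      by (simp_all only: r_def power2_eq_square power3_eq_cube powr_add)
    thus "0 < r" "r^3 = \<delta>" "r^2 = \<delta> powr (2/3)"
      using assms(1) by (simp_all add: r_def)
  qed
  obtain s where s: "r < s" "s^2 / 2 < r^2 / 2 + \<eta>"
  proof -
    have "((\<lambda>s. s^2 / 2) \<longlongrightarrow> r^2 / 2) (at_right r)"
      by (auto intro!: tendsto_eq_intros)
    hence "\<forall>\<^sub>F s in at_right r. s^2 / 2 < r^2 / 2 + \<eta>"
      using assms(2) by (intro order_tendstoD(2)) auto
    moreover have "\<forall>\<^sub>F s in at_right r. r < s"
      by (rule eventually_at_right_less)
    ultimately have "\<forall>\<^sub>F s in at_right r. r < s \<and> s^2 / 2 < r^2 / 2 + \<eta>"
      by eventually_elim auto
    from eventually_happens'[OF _ this] show ?thesis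
      using that by auto
  qed
  have "0 < s"
    using r s by linarith
  define M where "M n = real n * p n" for n
  have M: "filterlim M at_top sequentially"
    unfolding M_def by (rule assms(5))
  have M': "(\<lambda>n. c / M n) \<longlonglongrightarrow> 0" for c :: real
    by (rule tendsto_divide_0[OF tendsto_const filterlim_at_top_imp_at_infinity[OF M]])
  have "\<delta> < s^3"
    using r s power_strict_mono[of r s 3] by simp
  \<comment> \<open>This is the hypothesis of \<open>phi_le_clique\<close> divided by
    \<open>M n ^ 3\<close>, with \<open>a\<close> replaced by its lower bound \<open>s * M n\<close>
    and \<open>p n ^ 3 * n ^ 2\<close> by \<open>M n ^ 2\<close>.\<close>
  have "(\<lambda>n. (1 - p n ^ 3) * (s^2 * (s - 3 / M n)) - (\<delta> + 3 / M n))
      \<longlonglongrightarrow> (1 - 0 ^ 3) * (s^2 * (s - 0)) - (\<delta> + 0)"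
    by (intro tendsto_intros assms(4) M')
  hence "\<forall>\<^sub>F n in sequentially. 0 < (1 - p n ^ 3) * (s^2 * (s - 3 / M n)) - (\<delta> + 3 / M n)"
    using \<open>\<delta> < s^3\<close> by (intro order_tendstoD(1)) (auto simp: power2_eq_square power3_eq_cube)
  moreover have "(\<lambda>n. s * p n + 1 / real n) \<longlonglongrightarrow> s * 0 + 0"
    by (intro tendsto_intros assms(4) lim_1_over_n)
  hence "\<forall>\<^sub>F n in sequentially. s * p n + 1 / real n < 1"
    by (intro order_tendstoD(2)) auto
  moreover have "(\<lambda>n. (s + 1 / M n)^2 / 2) \<longlonglongrightarrow> (s + 0)^2 / 2"
    by (intro tendsto_intros M') auto
  hence "\<forall>\<^sub>F n in sequentially. (s + 1 / M n)^2 / 2 < r^2 / 2 + \<eta>"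
    using s by (intro order_tendstoD(2)) auto
  \<comment> \<open>Makes \<open>s * M n - 3\<close> nonnegative, so that
    \<open>t^2 * (t - 3)\<close> can be compared factor by factor at \<open>s * M n\<close> and
    \<open>a\<close>.\<close>
  moreover have "\<forall>\<^sub>F n in sequentially. 3 / s \<le> M n"
    using M unfolding filterlim_at_top by blast
  ultimately show ?thesis
    using eventually_ge_at_top[of 1]
  proof eventually_elim
    case (elim n)
    have p: "0 < p n" "p n < 1" and "0 < real n" "0 < M n"
      using assms(3)[of n] elim(5) by (auto simp: M_def)
    define a where "a = nat \<lceil>s * M n\<rceil>"
    have "0 < s * M n"
      using \<open>0 < s\<close> \<open>0 < M n\<close> by simp
    hence a: "s * M n \<le> real a" "real a \<le> s * M n + 1"
      unfolding a_def by linarith+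
    have "s * M n + 1 = (s * p n + 1 / real n) * real n"
      using \<open>0 < real n\<close> by (simp add: M_def field_simps)
    also have "\<dots> \<le> 1 * real n"
      using elim(2) by (intro mult_right_mono) auto
    finally have "a \<le> n"
      using a(2) by linarith
    have "\<delta> * M n ^ 3 + 3 * M n ^ 2 = (\<delta> + 3 / M n) * M n ^ 3"
      using \<open>0 < M n\<close> by (simp add: field_simps power2_eq_square power3_eq_cube)
    also have "\<dots> \<le> (1 - p n ^ 3) * (s^2 * (s - 3 / M n)) * M n ^ 3"
      using elim(1) \<open>0 < M n\<close> by (intro mult_right_mono) auto
    also have "\<dots> = (1 - p n ^ 3) * ((s * M n)^2 * (s * M n - 3))"
      using \<open>0 < M n\<close> by (simp add: field_simps power2_eq_square power3_eq_cube)
    also have "\<dots> \<le> (1 - p n ^ 3) * (real a ^ 2 * (real a - 3))"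
    proof -
      have "3 \<le> s * M n"
        using elim(4) \<open>0 < s\<close> by (simp add: field_simps)
      moreover have "p n ^ 3 \<le> 1"
        using p by (intro power_le_one) auto
      ultimately show ?thesis
        using a(1) by (intro mult_left_mono mult_mono power_mono) auto
    qed
    finally have "\<delta> * M n ^ 3 + 3 * M n ^ 2 \<le> (1 - p n ^ 3) * (real a ^ 3 - 3 * real a ^ 2)"
      by (simp add: algebra_simps power2_eq_square power3_eq_cube)
    moreover have "p n ^ 3 * real n ^ 2 \<le> M n ^ 2"
    proof -
      have "p n ^ 3 \<le> p n ^ 2"
        using p by (intro power_decreasing) auto
      hence "p n ^ 3 * real n ^ 2 \<le> p n ^ 2 * real n ^ 2"
        by (intro mult_right_mono) auto
      thus ?thesis
        by (simp add: M_def power_mult_distrib mult.commute)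
    qed
    moreover have "p n ^ 3 * real n ^ 3 = M n ^ 3"
      by (simp add: M_def power_mult_distrib)
    ultimately have "phi n (p n) \<delta> \<le> ereal (real a ^ 2 / 2 * ln (1 / p n))"
      using p elim(5) \<open>a \<le> n\<close> by (intro phi_le_clique) (auto simp: algebra_simps)
    also have "real a ^ 2 / 2 * ln (1 / p n) \<le> (r^2 / 2 + \<eta>) * M n ^ 2 * ln (1 / p n)"
    proof (rule mult_right_mono)
      have "real a ^ 2 \<le> (s * M n + 1) ^ 2"
        using a(2) by (intro power_mono) auto
      also have "\<dots> = (s + 1 / M n)^2 * M n ^ 2"
        using \<open>0 < M n\<close> by (simp add: field_simps flip: power_mult_distrib)
      also have "\<dots> \<le> (2 * (r^2 / 2 + \<eta>)) * M n ^ 2"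
        using elim(3) by (intro mult_right_mono) auto
      also have "\<dots> = 2 * ((r^2 / 2 + \<eta>) * M n ^ 2)"
        by (rule mult.assoc)
      finally show "real a ^ 2 / 2 \<le> (r^2 / 2 + \<eta>) * M n ^ 2"
        by linarith
    qed (use p in auto)
    finally show ?case
      by (simp add: r M_def power_mult_distrib mult.assoc)
  qed
qed

text \<open>The number of hubs is \<open>s * n * p^2\<close> rounded up, with \<open>s\<close>
  strictly between \<open>\<delta> / 3\<close> and \<open>\<delta> / 3 + \<eta>\<close>: the lower
  gap pays for the lost triangles, the upper gap for rounding, which is negligible because
  \<open>n * p^2\<close> tends to infinity.\<close>

lemma eventually_phi_le_hub:
  fixes p :: "nat \<Rightarrow> real"
  assumes "0 < \<delta>" "0 < \<eta>" "\<And>n. n \<ge> 1 \<Longrightarrow> 0 < p n \<and> p n < 1"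
    and "p \<longlonglongrightarrow> 0" "filterlim (\<lambda>n. real n * p n ^ 2) at_top sequentially"
  shows "\<forall>\<^sub>F n in sequentially.
    phi n (p n) \<delta> \<le> ereal ((\<delta> / 3 + \<eta>) * (real n ^ 2 * p n ^ 2 * ln (1 / p n)))"
proof -
  define s where "s = \<delta> / 3 + \<eta> / 2"
  have "0 < s" "\<delta> < 3 * s" "s < \<delta> / 3 + \<eta>"
    using assms(1,2) by (auto simp: s_def)
  define M where "M n = real n * p n ^ 2" for n
  have M: "filterlim M at_top sequentially"
    unfolding M_def by (rule assms(5))
  \<comment> \<open>\<open>q n\<close> is an upper bound for the fraction \<open>a / n\<close> of
    hubs; the summand \<open>1 / n\<close> comes from rounding up.\<close>
  define q where "q n = s * p n ^ 2 + 1 / real n" for n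
  have "q \<longlonglongrightarrow> s * 0 ^ 2 + 0"
    unfolding q_def by (intro tendsto_intros assms(4) lim_1_over_n)
  hence q: "q \<longlonglongrightarrow> 0"
    by simp
  have "(\<lambda>n. 3 * (1 - p n ^ 2) * s * ((1 - q n) * (1 - q n - 1 / real n)) - (\<delta> + 3 * (1 / real n)))
      \<longlonglongrightarrow> 3 * (1 - 0 ^ 2) * s * ((1 - 0) * (1 - 0 - 0)) - (\<delta> + 3 * 0)"
    by (intro tendsto_intros assms(4) q lim_1_over_n)
  hence "\<forall>\<^sub>F n in sequentially.
      0 < 3 * (1 - p n ^ 2) * s * ((1 - q n) * (1 - q n - 1 / real n)) - (\<delta> + 3 * (1 / real n))"
    using \<open>\<delta> < 3 * s\<close> by (intro order_tendstoD(1)) auto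
  moreover have "(\<lambda>n. q n + 1 / real n) \<longlonglongrightarrow> 0 + 0"
    by (intro tendsto_intros q lim_1_over_n)
  hence "\<forall>\<^sub>F n in sequentially. q n + 1 / real n < 1"
    by (intro order_tendstoD(2)) auto
  moreover have "(\<lambda>n. s + 1 / M n) \<longlonglongrightarrow> s + 0"
    by (intro tendsto_intros tendsto_divide_0[OF tendsto_const filterlim_at_top_imp_at_infinity[OF M]])
  hence "\<forall>\<^sub>F n in sequentially. s + 1 / M n < \<delta> / 3 + \<eta>"
    using \<open>s < \<delta> / 3 + \<eta>\<close> by (intro order_tendstoD(2)) auto
  ultimately show ?thesis
    using eventually_ge_at_top[of 1]
  proof eventually_elim
    case (elim n)
    define N where "N = real n"
    have p: "0 < p n" "p n < 1" and "0 < N" "0 < M n"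
      using assms(3)[of n] elim(4) by (auto simp: M_def N_def)
    have "0 < 1 / real n"
      using elim(4) by simp
    with elim(2) have "q n \<le> 1"
      by linarith
    define a where "a = nat \<lceil>s * M n\<rceil>"
    have "0 < s * M n"
      using \<open>0 < s\<close> \<open>0 < M n\<close> by simp
    hence a: "s * M n \<le> real a" "real a \<le> s * M n + 1"
      unfolding a_def by linarith+
    have "s * M n + 1 = q n * N"
      using \<open>0 < N\<close> by (simp add: M_def q_def N_def field_simps)
    hence aq: "real a \<le> q n * N"
      using a(2) by simp
    also have "\<dots> \<le> 1 * N"
      using \<open>q n \<le> 1\<close> \<open>0 < N\<close> by (intro mult_right_mono) auto
    finally have "a \<le> n"
      by (simp add: N_def)
    have "p n ^ 2 \<le> 1"
      using p by (intro power_le_one) auto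
    have "\<delta> * p n ^ 3 * N ^ 3 + 3 * p n ^ 3 * N ^ 2 = (\<delta> + 3 * (1 / N)) * (p n ^ 3 * N ^ 3)"
      using \<open>0 < N\<close> by (simp add: field_simps power2_eq_square power3_eq_cube)
    also have "\<dots> \<le> 3 * (1 - p n ^ 2) * s * ((1 - q n) * (1 - q n - 1 / N)) * (p n ^ 3 * N ^ 3)"
      using elim(1) p \<open>0 < N\<close> by (intro mult_right_mono) (auto simp: N_def)
    also have "\<dots> = 3 * (p n - p n ^ 3) * (s * M n * ((N - q n * N) * (N - q n * N - 1)))"
      using \<open>0 < N\<close> by (simp add: field_simps power2_eq_square power3_eq_cube M_def flip: N_def)
    also have "\<dots> \<le> 3 * (p n - p n ^ 3) * (real a * ((N - real a) * (N - real a - 1)))"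
    proof -
      have "(q n + 1 / N) * N \<le> 1 * N"
        using elim(2) \<open>0 < N\<close> by (intro mult_right_mono) (auto simp: N_def)
      hence "0 \<le> N - q n * N - 1"
        using \<open>0 < N\<close> by (simp add: algebra_simps)
      moreover have "p n ^ 3 \<le> p n"
        using p power_decreasing[of 1 3 "p n"] by simp
      ultimately show ?thesis
        using a(1) aq \<open>q n \<le> 1\<close> \<open>0 < N\<close> by (intro mult_left_mono mult_mono mult_nonneg_nonneg) auto
    qed
    finally have "phi n (p n) \<delta> \<le> ereal (real a * real n * ln (1 / p n))"
      using p elim(4) \<open>a \<le> n\<close>
      by (intro phi_le_hub) (auto simp: algebra_simps power2_eq_square power3_eq_cube N_def)
    also have "real a * real n * ln (1 / p n) \<le> (\<delta> / 3 + \<eta>) * (real n ^ 2 * p n ^ 2) * ln (1 / p n)"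
    proof (rule mult_right_mono)
      have "real a * N \<le> (s * M n + 1) * N"
        using a(2) \<open>0 < N\<close> by (intro mult_right_mono) auto
      also have "\<dots> = (s + 1 / M n) * (M n * N)"
        using \<open>0 < M n\<close> by (simp add: field_simps)
      also have "\<dots> \<le> (\<delta> / 3 + \<eta>) * (M n * N)"
        using elim(3) \<open>0 < M n\<close> \<open>0 < N\<close> by (intro mult_right_mono) auto
      also have "M n * N = real n ^ 2 * p n ^ 2"
        by (simp add: M_def N_def power2_eq_square)
      finally show "real a * real n \<le> (\<delta> / 3 + \<eta>) * (real n ^ 2 * p n ^ 2)"
        by (simp add: N_def)
    qed (use p in auto)
    finally show ?case
      by (simp add: mult.assoc)
  qed
qed

section \<open>From asymptotic bounds to limits\<close>

lemma ereal_quotient_tendsto: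
  fixes f :: "nat \<Rightarrow> ereal" and d :: "nat \<Rightarrow> real"
  assumes "\<forall>\<^sub>F n in sequentially. 0 < d n"
    and "\<And>\<eta>. 0 < \<eta> \<Longrightarrow> \<forall>\<^sub>F n in sequentially. ereal ((m - \<eta>) * d n) \<le> f n"
    and "\<And>\<eta>. 0 < \<eta> \<Longrightarrow> \<forall>\<^sub>F n in sequentially. f n \<le> ereal ((m + \<eta>) * d n)"
  shows "(\<lambda>n. f n / ereal (d n)) \<longlonglongrightarrow> ereal m"
proof (rule order_tendstoI)
  fix x
  assume "x < ereal m"
  \<comment> \<open>A real \<open>z\<close> strictly between turns the extended-real neighbourhood
    into the hypothesis with slack \<open>m - z\<close>.\<close>
  then obtain z where z: "x < ereal z" "z < m"
    using ereal_dense2 by (metis ereal_less_eq(3) ereal_less(2) less_ereal.simps(1))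
  hence "\<forall>\<^sub>F n in sequentially. ereal ((m - (m - z)) * d n) \<le> f n"
    by (intro assms(2)) simp
  with assms(1) show "\<forall>\<^sub>F n in sequentially. x < f n / ereal (d n)"
  proof eventually_elim
    case (elim n)
    hence "ereal z \<le> f n / ereal (d n)"
      by (subst ereal_le_divide_pos) (auto simp: mult.commute)
    with z(1) show ?case
      by (rule less_le_trans)
  qed
next
  fix x
  assume "ereal m < x"
  then obtain z where z: "ereal z < x" "m < z"
    using ereal_dense2 by (metis less_ereal.simps(1))
  hence "\<forall>\<^sub>F n in sequentially. f n \<le> ereal ((m + (z - m)) * d n)"
    by (intro assms(3)) simp
  with assms(1) show "\<forall>\<^sub>F n in sequentially. f n / ereal (d n) < x"
  proof eventually_elim
    case (elim n)
    hence "f n / ereal (d n) \<le> ereal z"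
      by (subst ereal_divide_le_pos) (auto simp: mult.commute)
    with z(1) show ?case
      by (rule le_less_trans[rotated])
  qed
qed

section \<open>The variational problem\<close>

lemma le_phiI:
  assumes "\<And>g. g \<in> weighted_graphs n \<Longrightarrow> (1 + \<delta>) * p^3 \<le> triangle_density n g \<Longrightarrow> c \<le> graph_entropy n p g"
  shows "ereal c \<le> phi n p \<delta>"
  unfolding phi_def using assms by (intro INF_greatest) auto

theorem theorem1p1:
  fixes \<delta> :: real and p :: "nat \<Rightarrow> real"
  assumes "\<delta> > 0"
    and "\<And>n. n \<ge> 1 \<Longrightarrow> 0 < p n \<and> p n < 1"
  shows "(filterlim (\<lambda>n. real n powr (1/2) * p n) at_top sequentially \<and> p \<longlonglongrightarrow> 0 \<longrightarrow>
           (\<lambda>n. phi n (p n) \<delta> / ereal (real n ^ 2 * p n ^ 2 * ln (1 / p n)))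
             \<longlonglongrightarrow> ereal (min (\<delta> powr (2/3) / 2) (\<delta> / 3))) \<and>
         (filterlim (\<lambda>n. real n * p n) at_top sequentially \<and>
          (\<lambda>n. real n powr (1/2) * p n) \<longlonglongrightarrow> 0 \<longrightarrow>
           (\<lambda>n. phi n (p n) \<delta> / ereal (real n ^ 2 * p n ^ 2 * ln (1 / p n)))
             \<longlonglongrightarrow> ereal (\<delta> powr (2/3) / 2))"
proof -
  define D where "D n = real n ^ 2 * p n ^ 2 * ln (1 / p n)" for n
  have pos: "\<forall>\<^sub>F n in sequentially. 0 < p n \<and> p n < 1"
    using eventually_ge_at_top[of 1] by eventually_elim (use assms(2) in auto)
  have D: "\<forall>\<^sub>F n in sequentially. 0 < D n"
    using eventually_ge_at_top[of 1]
  proof eventually_elim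
    case (elim n)
    thus ?case
      using assms(2)[of n] by (simp add: D_def)
  qed
  \<comment> \<open>Squaring turns both assumptions on \<open>n powr (1/2) * p\<close> into
    statements about \<open>n * p^2\<close>, the order of the number of hubs.\<close>
  have sq: "(real n powr (1/2) * p n)^2 = real n * p n ^ 2" for n
    by (simp add: power_mult_distrib powr_half_sqrt)
  have right: "filterlim p (at_right 0) sequentially" if "p \<longlonglongrightarrow> 0"
    using that pos by (auto simp: filterlim_at elim: eventually_mono)
  have small: "p n \<le> real n powr (1/2) * p n" if "n \<ge> 1" for n
    using that assms(2)[OF that] by (simp add: powr_half_sqrt)

  have "(\<lambda>n. phi n (p n) \<delta> / ereal (D n)) \<longlonglongrightarrow> ereal (min (\<delta> powr (2/3) / 2) (\<delta> / 3))"
    if lim: "filterlim (\<lambda>n. real n powr (1/2) * p n) at_top sequentially" "p \<longlonglongrightarrow> 0"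
  proof (rule ereal_quotient_tendsto[OF D])
    fix \<eta> :: real
    assume "0 < \<eta>"
    obtain c where "0 < c" and ev: "\<forall>\<^sub>F p in at_right 0. \<forall>n g. n \<ge> 1 \<longrightarrow> g \<in> weighted_graphs n \<longrightarrow>
       (1 + \<delta>) * p^3 \<le> triangle_density n g \<longrightarrow>
       (min (\<delta> powr (2/3) / 2) (\<delta> / 3) - \<eta>) * (real n ^ 2 * p ^ 2 * ln (1 / p)) \<le> graph_entropy n p g \<and>
       (real n * p^2 < c \<longrightarrow>
         (\<delta> powr (2/3) / 2 - \<eta>) * (real n ^ 2 * p ^ 2 * ln (1 / p)) \<le> graph_entropy n p g)"
      using eventually_graph_entropy_ge[OF assms(1) \<open>0 < \<eta>\<close>] by blast
    from eventually_compose_filterlim[OF ev right[OF lim(2)]] eventually_ge_at_top[of 1]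
    show "\<forall>\<^sub>F n in sequentially. ereal ((min (\<delta> powr (2/3) / 2) (\<delta> / 3) - \<eta>) * D n) \<le> phi n (p n) \<delta>"
      by eventually_elim (auto simp: D_def intro!: le_phiI)
    have np2: "filterlim (\<lambda>n. real n * p n ^ 2) at_top sequentially"
      using filterlim_pow_at_top[OF _ lim(1), of 2] by (simp add: sq)
    have np: "filterlim (\<lambda>n. real n * p n) at_top sequentially"
    proof (rule filterlim_at_top_mono[OF lim(1)])
      show "\<forall>\<^sub>F n in sequentially. real n powr (1/2) * p n \<le> real n * p n"
        using eventually_ge_at_top[of 1]
      proof eventually_elim
        case (elim n)
        hence "real n powr (1/2) \<le> real n powr 1"
          by (intro powr_mono) auto
        with elim assms(2)[OF elim] show ?case
          by simp
      qed
    qed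
    \<comment> \<open>Both constructions are available in this regime, so the cheaper one gives the
      minimum.\<close>
    have "\<forall>\<^sub>F n in sequentially. phi n (p n) \<delta> \<le> ereal ((\<delta> powr (2/3) / 2 + \<eta>) * D n)"
      unfolding D_def using assms(1) \<open>0 < \<eta>\<close> assms(2) lim(2) np by (rule eventually_phi_le_clique)
    moreover have "\<forall>\<^sub>F n in sequentially. phi n (p n) \<delta> \<le> ereal ((\<delta> / 3 + \<eta>) * D n)"
      unfolding D_def using assms(1) \<open>0 < \<eta>\<close> assms(2) lim(2) np2 by (rule eventually_phi_le_hub)
    ultimately show "\<forall>\<^sub>F n in sequentially. phi n (p n) \<delta> \<le> ereal ((min (\<delta> powr (2/3) / 2) (\<delta> / 3) + \<eta>) * D n)"
      by eventually_elim (auto simp: min_def)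
  qed
  moreover have "(\<lambda>n. phi n (p n) \<delta> / ereal (D n)) \<longlonglongrightarrow> ereal (\<delta> powr (2/3) / 2)"
    if lim: "filterlim (\<lambda>n. real n * p n) at_top sequentially" "(\<lambda>n. real n powr (1/2) * p n) \<longlonglongrightarrow> 0"
  proof (rule ereal_quotient_tendsto[OF D])
    have p0: "p \<longlonglongrightarrow> 0"
    proof (rule tendsto_sandwich[OF _ _ tendsto_const lim(2)])
      show "\<forall>\<^sub>F n in sequentially. 0 \<le> p n"
        using pos by eventually_elim auto
      show "\<forall>\<^sub>F n in sequentially. p n \<le> real n powr (1/2) * p n"
        using eventually_ge_at_top[of 1] by eventually_elim (rule small)
    qed
    fix \<eta> :: real
    assume "0 < \<eta>"
    obtain c where "0 < c" and ev: "\<forall>\<^sub>F p in at_right 0. \<forall>n g. n \<ge> 1 \<longrightarrow> g \<in> weighted_graphs n \<longrightarrow>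
       (1 + \<delta>) * p^3 \<le> triangle_density n g \<longrightarrow>
       (min (\<delta> powr (2/3) / 2) (\<delta> / 3) - \<eta>) * (real n ^ 2 * p ^ 2 * ln (1 / p)) \<le> graph_entropy n p g \<and>
       (real n * p^2 < c \<longrightarrow>
         (\<delta> powr (2/3) / 2 - \<eta>) * (real n ^ 2 * p ^ 2 * ln (1 / p)) \<le> graph_entropy n p g)"
      using eventually_graph_entropy_ge[OF assms(1) \<open>0 < \<eta>\<close>] by blast
    \<comment> \<open>Once \<open>n * p^2\<close> is below \<open>c\<close> there are no heavy
      vertices, and the sharper conjunct of \<open>ev\<close> applies.\<close>
    have "(\<lambda>n. real n * p n ^ 2) \<longlonglongrightarrow> 0"
      using tendsto_power[OF lim(2), of 2] by (simp add: sq)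
    hence "\<forall>\<^sub>F n in sequentially. real n * p n ^ 2 < c"
      using \<open>0 < c\<close> by (intro order_tendstoD(2))
    with eventually_compose_filterlim[OF ev right[OF p0]] eventually_ge_at_top[of 1]
    show "\<forall>\<^sub>F n in sequentially. ereal ((\<delta> powr (2/3) / 2 - \<eta>) * D n) \<le> phi n (p n) \<delta>"
      by eventually_elim (auto simp: D_def intro!: le_phiI)
    show "\<forall>\<^sub>F n in sequentially. phi n (p n) \<delta> \<le> ereal ((\<delta> powr (2/3) / 2 + \<eta>) * D n)"
      unfolding D_def using assms(1) \<open>0 < \<eta>\<close> assms(2) p0 lim(1) by (rule eventually_phi_le_clique)
  qed
  ultimately show ?thesis
    by (simp add: D_def)
qed

end
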